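(* Let $v: G \rightarrow [0,\infty[$ be a weight on a planar domain $G$, let $\tau$ be the topology on $H^\infty_v(G)$ defined by the norms $\|f\|_n := \sup_{z \in K_n} |f(z)| + \|f\|_v$, $n\in\mathbb{N}$, where $(K_n)_n$ is a fundamental sequence of compact subsets of $G$, and let $\tau_v$ be the topology on $H^\infty_v(G)$ induced by the seminorm $\|\cdot\|_v$. (i) The topology $\tau$ is coarser than $\tau_v$ if and only if the two topologies coincide; equivalently, if and only if $(H^\infty_v(G),\|\cdot\|_v)$ is a Banach space. (ii) The topology $\tau$ is normable if and only if there is a compact set $K$ in $G$ such that, for the weight $w(z):=v(z)+\chi_K(z)$, $z \in G$, where $\chi_K$ is the characteristic function of $K$, the space $H^\infty_w(G)$ is a Banach space. (iii) If $E_v$ is contained in a compact subset of $G$ and $v$ is bounded, then $\tau$ coincides with the compact-open topology $\tau_{co}$ on $H^\infty_v(G)$. Under the assumptions that $H^\infty_v(G)$ contains the polynomials and $G$ is simply connected, the converse also holds: if $\tau=\tau_{co}$ on $H^\infty_v(G)$, then there is a compact set $K$ in $G$ such that $E_v \subset K$. (iv) If the topology $\tau$ is normable, then $E_v$ is not discrete.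
   Context: A planar domain is a (nonempty) open connected subset $G$ of $\mathbb{C}$. A weight on $G$ is an arbitrary function $v:G\to[0,\infty[$ (not assumed continuous, bounded, or strictly positive unless stated). $H(G)$ is the space of holomorphic functions on $G$ and $\tau_{co}$ is the topology of uniform convergence on compact subsets of $G$ (also denoting its restriction to subspaces). $H^\infty_v(G):=\{f\in H(G) : \|f\|_v:=\sup_{z\in G} v(z)|f(z)|<+\infty\}$, endowed with the seminorm $\|\cdot\|_v$; saying it is a Banach space means that $\|\cdot\|_v$ is a norm and is complete. $E_v:=\{z\in G : v(z)>0\}$; "$E_v$ is discrete" means that $E_v$ has no limit point in $G$. A fundamental sequence of compact subsets of $G$ is an increasing sequence $(K_n)_n$ of compact subsets of $G$ such that every compact subset of $G$ is contained in some $K_n$. A locally convex topology $\sigma$ on a vector space $X$ is normable if there is a norm on $X$ inducing $\sigma$. "Coarser" is understood in the non-strict sense. *)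

theory Defs
  imports "HOL-Complex_Analysis.Complex_Analysis" "HOL-Library.Function_Algebras"
begin

definition planar_domain :: "complex set \<Rightarrow> bool" where
  "planar_domain G \<longleftrightarrow> G \<noteq> {} \<and> open G \<and> connected G"

definition weight_on :: "complex set \<Rightarrow> (complex \<Rightarrow> real) \<Rightarrow> bool" where
  "weight_on G v \<longleftrightarrow> (\<forall>z\<in>G. 0 \<le> v z)"

text \<open>Functions on \<open>G\<close> are represented by total functions vanishing off \<open>G\<close>. Thus functions that
  agree on \<open>G\<close> are equal, and the spaces below are linear subspaces of the space
  \<^typ>\<open>complex \<Rightarrow> complex\<close> with the pointwise operations.\<close>

definition restrict0 :: "complex set \<Rightarrow> (complex \<Rightarrow> complex) \<Rightarrow> complex \<Rightarrow> complex" where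
  "restrict0 G f = (\<lambda>z. if z \<in> G then f z else 0)"

definition holo :: "complex set \<Rightarrow> (complex \<Rightarrow> complex) set" where
  "holo G = {f. f holomorphic_on G \<and> (\<forall>z. z \<notin> G \<longrightarrow> f z = 0)}"

definition wnorm :: "complex set \<Rightarrow> (complex \<Rightarrow> real) \<Rightarrow> (complex \<Rightarrow> complex) \<Rightarrow> real" where
  "wnorm G v f = (SUP z\<in>G. v z * cmod (f z))"

definition Hv :: "complex set \<Rightarrow> (complex \<Rightarrow> real) \<Rightarrow> (complex \<Rightarrow> complex) set" where
  "Hv G v = {f \<in> holo G. bdd_above ((\<lambda>z. v z * cmod (f z)) ` G)}"

text \<open>Inserting 0 gives the supremum over the empty set the value 0; it changes nothing otherwise.\<close>

definition supnorm :: "complex set \<Rightarrow> (complex \<Rightarrow> complex) \<Rightarrow> real" where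
  "supnorm S f = Sup (insert 0 ((\<lambda>z. cmod (f z)) ` S))"

definition positive_set :: "complex set \<Rightarrow> (complex \<Rightarrow> real) \<Rightarrow> complex set" where
  "positive_set G v = {z \<in> G. 0 < v z}"

definition discrete_in :: "complex set \<Rightarrow> complex set \<Rightarrow> bool" where
  "discrete_in G E \<longleftrightarrow> (\<forall>z\<in>G. \<not> z islimpt E)"

definition fundamental_sequence :: "complex set \<Rightarrow> (nat \<Rightarrow> complex set) \<Rightarrow> bool" where
  "fundamental_sequence G K \<longleftrightarrow>
     incseq K \<and> (\<forall>n. compact (K n) \<and> K n \<subseteq> G) \<and>
     (\<forall>L. compact L \<and> L \<subseteq> G \<longrightarrow> (\<exists>n. L \<subseteq> K n))"

definition norm_on ::
    "(complex \<Rightarrow> complex) set \<Rightarrow> ((complex \<Rightarrow> complex) \<Rightarrow> real) \<Rightarrow> bool" where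
  "norm_on X p \<longleftrightarrow>
     (\<forall>f\<in>X. 0 \<le> p f) \<and>
     (\<forall>f\<in>X. p f = 0 \<longleftrightarrow> f = 0) \<and>
     (\<forall>c. \<forall>f\<in>X. p (\<lambda>z. c * f z) = cmod c * p f) \<and>
     (\<forall>f\<in>X. \<forall>g\<in>X. p (f + g) \<le> p f + p g)"

definition banach_on ::
    "(complex \<Rightarrow> complex) set \<Rightarrow> ((complex \<Rightarrow> complex) \<Rightarrow> real) \<Rightarrow> bool" where
  "banach_on X p \<longleftrightarrow> norm_on X p \<and>
     (\<forall>f::nat \<Rightarrow> complex \<Rightarrow> complex.
        range f \<subseteq> X \<and> (\<forall>e>0. \<exists>N. \<forall>m\<ge>N. \<forall>n\<ge>N. p (f m - f n) < e) \<longrightarrow>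
        (\<exists>g\<in>X. (\<lambda>n. p (f n - g)) \<longlonglongrightarrow> 0))"

text \<open>The topology on \<open>X\<close> defined by a nonempty family \<open>P\<close> of seminorms: the open balls of its
  members form a subbase.\<close>

definition seminorm_topology ::
    "(complex \<Rightarrow> complex) set \<Rightarrow> ((complex \<Rightarrow> complex) \<Rightarrow> real) set \<Rightarrow>
     (complex \<Rightarrow> complex) topology" where
  "seminorm_topology X P =
     topology_generated_by {{g \<in> X. p (g - f) < e} | p f e. p \<in> P \<and> f \<in> X \<and> 0 < e}"

definition normable ::
    "(complex \<Rightarrow> complex) set \<Rightarrow> (complex \<Rightarrow> complex) topology \<Rightarrow> bool" where
  "normable X T \<longleftrightarrow> (\<exists>p. norm_on X p \<and> T = seminorm_topology X {p})"

definition coarser :: "'a topology \<Rightarrow> 'a topology \<Rightarrow> bool" where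
  "coarser S T \<longleftrightarrow> topspace S = topspace T \<and> (\<forall>U. openin S U \<longrightarrow> openin T U)"

definition tau_co :: "complex set \<Rightarrow> (complex \<Rightarrow> complex) topology" where
  "tau_co G = seminorm_topology (holo G) {supnorm L | L. compact L \<and> L \<subseteq> G}"

definition tau_v :: "complex set \<Rightarrow> (complex \<Rightarrow> real) \<Rightarrow> (complex \<Rightarrow> complex) topology" where
  "tau_v G v = seminorm_topology (Hv G v) {wnorm G v}"

definition tau ::
    "complex set \<Rightarrow> (complex \<Rightarrow> real) \<Rightarrow> (nat \<Rightarrow> complex set) \<Rightarrow> (complex \<Rightarrow> complex) topology" where
  "tau G v K = seminorm_topology (Hv G v) (range (\<lambda>n f. supnorm (K n) f + wnorm G v f))"

end

theory Submission
  imports Defs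
begin

text \<open>
  All the topologies involved are defined by directed families of seminorms, and for these
  inclusion of topologies means that each seminorm of the coarser one is dominated by a multiple of
  a seminorm of the finer one (\<open>seminorm_topology_le_iff\<close>). This translates the claims into inequalities.

  The topology \<open>tau\<close> is always finer than \<open>tau_v\<close>, and it is coarser exactly if the weighted norm
  dominates the suprema over all \<open>K n\<close>. If it does, Cauchy sequences for the weighted norm converge
  locally uniformly, whence completeness. The converse is an instance of the closed graph theorem:
  a locally uniform limit and a limit in the weighted norm agree, since their difference has weighted
  norm \<open>0\<close> (\<open>banach_Hv_iff_dominates_supnorms\<close>, by way of \<open>banach_dominates_closable_seminorms\<close>).

  A norm inducing \<open>tau\<close> is equivalent to one of the defining seminorms
  \<open>supnorm (K n) f + wnorm G v f\<close>, and adding the indicator of \<open>L = K n\<close> to the weight produces an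
  equivalent norm. So normability of \<open>tau\<close> reduces to the Banach criterion for the new
  weight (\<open>normable_tau_iff\<close>).

  The topology \<open>tau\<close> is the compact-open one exactly if the weighted seminorm is bounded by a multiple
  of the supremum over some compact \<open>L\<close> (\<open>tau_eq_compact_open_iff\<close>), which is clear for bounded weights with compactly
  contained positivity set. Conversely, applying such a bound to powers \<open>u ^ n\<close> forces \<open>v\<close> to vanish
  where \<open>u\<close> is larger than on \<open>L\<close>. For \<open>u\<close> a Riemann map of \<open>G\<close> onto the disc, or the identity if \<open>G\<close> is the
  plane, this confines the positivity set to a compact set.

  If \<open>tau\<close> is normable, then point evaluations are bounded by the weighted norm for \<open>v\<close> plus the
  indicator of some \<open>L\<close>. For a discrete positivity set, a Weierstrass product \<open>h\<close> vanishes on it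
  (\<open>holomorphic_with_prescribed_zeros\<close>), and the functions \<open>h * u ^ n\<close>, with \<open>u\<close> larger somewhere off \<open>L\<close> than
  on \<open>L\<close>, violate the bound (\<open>not_discrete_if_banach_add_indicator\<close>).
\<close>

section \<open>Topologies defined by directed families of seminorms\<close>

definition linear_subspace :: "(complex \<Rightarrow> complex) set \<Rightarrow> bool" where
  "linear_subspace X \<longleftrightarrow> 0 \<in> X \<and> (\<forall>f\<in>X. \<forall>g\<in>X. f + g \<in> X) \<and> (\<forall>c. \<forall>f\<in>X. (\<lambda>z. c * f z) \<in> X)"

definition seminorm_on :: "(complex \<Rightarrow> complex) set \<Rightarrow> ((complex \<Rightarrow> complex) \<Rightarrow> real) \<Rightarrow> bool" where
  "seminorm_on X p \<longleftrightarrow>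
     (\<forall>f\<in>X. 0 \<le> p f) \<and>
     (\<forall>c. \<forall>f\<in>X. p (\<lambda>z. c * f z) = cmod c * p f) \<and>
     (\<forall>f\<in>X. \<forall>g\<in>X. p (f + g) \<le> p f + p g)"

lemma linear_subspaceD:
  assumes "linear_subspace X"
  shows "0 \<in> X" "\<And>f g. f \<in> X \<Longrightarrow> g \<in> X \<Longrightarrow> f + g \<in> X"
    "\<And>f c. f \<in> X \<Longrightarrow> (\<lambda>z. c * f z) \<in> X" "\<And>f g. f \<in> X \<Longrightarrow> g \<in> X \<Longrightarrow> f - g \<in> X"
proof -
  have "f - g \<in> X" if "f \<in> X" "g \<in> X" for f g
  proof -
    have "f - g = f + (\<lambda>z. (-1) * g z)" by (auto simp: fun_eq_iff)
    then show ?thesis using assms that unfolding linear_subspace_def by presburger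
  qed
  then show "\<And>f g. f \<in> X \<Longrightarrow> g \<in> X \<Longrightarrow> f - g \<in> X" .
qed (use assms in \<open>auto simp: linear_subspace_def\<close>)

lemma seminorm_onD:
  assumes "seminorm_on X p"
  shows "f \<in> X \<Longrightarrow> 0 \<le> p f" "f \<in> X \<Longrightarrow> p (\<lambda>z. c * f z) = cmod c * p f"
    "f \<in> X \<Longrightarrow> g \<in> X \<Longrightarrow> p (f + g) \<le> p f + p g"
  using assms by (auto simp: seminorm_on_def)

lemma norm_on_iff_seminorm:
  "norm_on X p \<longleftrightarrow> seminorm_on X p \<and> (\<forall>f\<in>X. p f = 0 \<longleftrightarrow> f = 0)"
  by (auto simp: norm_on_def seminorm_on_def)

lemma seminorm_on_subset: "seminorm_on Y p \<Longrightarrow> X \<subseteq> Y \<Longrightarrow> seminorm_on X p"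
  unfolding seminorm_on_def by blast

lemma seminorm_on_add:
  assumes p: "seminorm_on X p" and q: "seminorm_on X q"
  shows "seminorm_on X (\<lambda>f. p f + q f)"
  unfolding seminorm_on_def
proof (intro conjI ballI allI)
  fix f g assume "f \<in> X" "g \<in> X"
  then show "p (f + g) + q (f + g) \<le> p f + q f + (p g + q g)"
    using seminorm_onD(3)[OF p, of f g] seminorm_onD(3)[OF q, of f g] by simp
qed (simp_all add: seminorm_onD(1,2)[OF p] seminorm_onD(1,2)[OF q] distrib_left)

lemma seminorm_zero:
  assumes "linear_subspace X" "seminorm_on X p"
  shows "p 0 = 0"
proof -
  have "p (\<lambda>z. 0 * 0 z) = cmod 0 * p 0"
    using seminorm_onD(2)[OF assms(2) linear_subspaceD(1)[OF assms(1)]] .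
  then show ?thesis by (simp add: zero_fun_def)
qed

lemma seminorm_minus_commute:
  assumes "linear_subspace X" "seminorm_on X p" "f \<in> X" "g \<in> X"
  shows "p (f - g) = p (g - f)"
proof -
  have "p (\<lambda>z. (-1) * (g - f) z) = cmod (-1) * p (g - f)"
    using seminorm_onD(2)[OF assms(2) linear_subspaceD(4)[OF assms(1,4,3)]] .
  moreover have "(\<lambda>z. (-1) * (g - f) z) = f - g" by (auto simp: fun_eq_iff)
  ultimately show ?thesis by simp
qed

lemma seminorm_triangle:
  assumes "linear_subspace X" "seminorm_on X p" "f \<in> X" "g \<in> X" "h \<in> X"
  shows "p (f - h) \<le> p (f - g) + p (g - h)"
proof -
  have "f - h = (f - g) + (g - h)" by simp
  then show ?thesis
    using seminorm_onD(3)[OF assms(2), of "f - g" "g - h"] linear_subspaceD(4)[OF assms(1)] assms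
    by simp
qed

text \<open>Homogeneity turns a bound on one ball of \<open>q\<close> into a global estimate. When \<open>q f = 0\<close> it says
  that \<open>p f = 0\<close> too: all multiples of \<open>f\<close> lie in the ball, so \<open>p\<close> stays bounded on a line.\<close>
lemma seminorm_bound_of_ball:
  assumes X: "linear_subspace X" and p: "seminorm_on X p" and q: "seminorm_on X q"
    and "0 < e" "0 < M" and imp: "\<And>f. f \<in> X \<Longrightarrow> q f < e \<Longrightarrow> p f \<le> M" and f: "f \<in> X"
  shows "p f \<le> (2 * M / e) * q f"
proof (rule ccontr)
  assume neg: "\<not> ?thesis"
  have q0: "0 \<le> q f" using q f by (rule seminorm_onD)
  then have pos: "0 < p f"
    using neg \<open>0 < e\<close> \<open>0 < M\<close> by (smt (verit) divide_nonneg_pos mult_nonneg_nonneg)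
  \<comment> \<open>Rescale \<open>f\<close> so that \<open>p\<close> takes the value \<open>2 * M\<close>; then \<open>q\<close> is below \<open>e\<close>.\<close>
  define t where "t = 2 * M / p f"
  have t: "0 < t" using pos \<open>0 < M\<close> by (simp add: t_def)
  have scale: "r (\<lambda>z. of_real t * f z) = t * r f" if "seminorm_on X r" for r
    using seminorm_onD(2)[OF that f, of "of_real t"] t by simp
  have "(2 * M / e) * q f < p f" using neg by simp
  then have "t * q f < e"
    using pos \<open>0 < e\<close> \<open>0 < M\<close> by (simp add: t_def field_simps)
  then have "p (\<lambda>z. of_real t * f z) \<le> M"
    using imp[OF linear_subspaceD(3)[OF X f]] scale[OF q] by simp
  then have "t * p f \<le> M" using scale[OF p] by simp
  then show False using pos \<open>0 < M\<close> by (simp add: t_def)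
qed

text \<open>Directedness lets a single member of the family replace the finite intersections of balls that
  a subbase would otherwise require.\<close>
definition directed_seminorms :: "(complex \<Rightarrow> complex) set \<Rightarrow> ((complex \<Rightarrow> complex) \<Rightarrow> real) set \<Rightarrow> bool" where
  "directed_seminorms X P \<longleftrightarrow> P \<noteq> {} \<and> (\<forall>p\<in>P. seminorm_on X p) \<and>
     (\<forall>p\<in>P. \<forall>q\<in>P. \<exists>r\<in>P. \<forall>f\<in>X. p f \<le> r f \<and> q f \<le> r f)"

lemma directed_seminorms_singleton: "seminorm_on X p \<Longrightarrow> directed_seminorms X {p}"
  by (auto simp: directed_seminorms_def)

lemma openin_seminorm_topology:
  assumes X: "linear_subspace X" and P: "directed_seminorms X P"
  shows "openin (seminorm_topology X P) U \<longleftrightarrow>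
    U \<subseteq> X \<and> (\<forall>f\<in>U. \<exists>p\<in>P. \<exists>e>0. {g \<in> X. p (g - f) < e} \<subseteq> U)"
    (is "_ \<longleftrightarrow> ?R U")
proof
  let ?B = "{{g \<in> X. p (g - f) < e} | p f e. p \<in> P \<and> f \<in> X \<and> 0 < e}"
  assume "openin (seminorm_topology X P) U"
  then have "generate_topology_on ?B U"
    unfolding seminorm_topology_def by (simp add: openin_topology_generated_by_iff)
  then show "?R U"
  proof induction
    case Empty
    then show ?case by auto
  next
    case (Int a b)
    show ?case
    proof (intro conjI ballI)
      fix f assume "f \<in> a \<inter> b"
      then have ab: "f \<in> a" "f \<in> b" by auto
      obtain p d where p: "p \<in> P" "0 < d" "{g \<in> X. p (g - f) < d} \<subseteq> a"
        using Int.IH(1) ab(1) by blast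
      obtain q e where q: "q \<in> P" "0 < e" "{g \<in> X. q (g - f) < e} \<subseteq> b"
        using Int.IH(2) ab(2) by blast
      have f: "f \<in> X" using Int.IH(1) ab(1) by blast
      obtain r where r: "r \<in> P" "\<forall>f\<in>X. p f \<le> r f \<and> q f \<le> r f"
        using P p(1) q(1) unfolding directed_seminorms_def by blast
      have "g \<in> a \<inter> b" if "g \<in> X" "r (g - f) < min d e" for g
      proof -
        have "p (g - f) \<le> r (g - f)" "q (g - f) \<le> r (g - f)"
          using r(2) linear_subspaceD(4)[OF X that(1) f] by auto
        then show ?thesis using that p(3) q(3) by auto
      qed
      then have "{g \<in> X. r (g - f) < min d e} \<subseteq> a \<inter> b" by blast
      moreover have "0 < min d e" using p q by simp
      ultimately show "\<exists>p\<in>P. \<exists>e>0. {g \<in> X. p (g - f) < e} \<subseteq> a \<inter> b"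
        using r(1) by blast
    qed (use Int.IH in blast)
  next
    case (UN K)
    show ?case
    proof (intro conjI ballI)
      show "\<Union>K \<subseteq> X" using UN.IH by blast
      fix f assume "f \<in> \<Union>K"
      then obtain k where k: "k \<in> K" "f \<in> k" by blast
      then obtain p e where "p \<in> P" "0 < e" "{g \<in> X. p (g - f) < e} \<subseteq> k" using UN.IH by meson
      then show "\<exists>p\<in>P. \<exists>e>0. {g \<in> X. p (g - f) < e} \<subseteq> \<Union>K" using k by blast
    qed
  next
    case (Basis s)
    then obtain p f e where s: "s = {g \<in> X. p (g - f) < e}" "p \<in> P" "f \<in> X" "0 < e" by auto
    have p: "seminorm_on X p" using P s by (auto simp: directed_seminorms_def)
    show ?case
    proof (intro conjI ballI)
      fix h assume "h \<in> s"
      then have h: "h \<in> X" "p (h - f) < e" using s by auto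
      have "{g \<in> X. p (g - h) < e - p (h - f)} \<subseteq> s"
        using seminorm_triangle[OF X p _ h(1) s(3)] s(1) by force
      then show "\<exists>p\<in>P. \<exists>e>0. {g \<in> X. p (g - h) < e} \<subseteq> s"
        using s(2) h(2) by (metis diff_gt_0_iff_gt)
    qed (use s in auto)
  qed
next
  let ?B = "{{g \<in> X. p (g - f) < e} | p f e. p \<in> P \<and> f \<in> X \<and> 0 < e}"
  assume R: "?R U"
  have "U = \<Union>{V \<in> ?B. V \<subseteq> U}"
  proof
    show "U \<subseteq> \<Union>{V \<in> ?B. V \<subseteq> U}"
    proof
      fix f assume f: "f \<in> U"
      then obtain p e where p: "p \<in> P" "0 < e" "{g \<in> X. p (g - f) < e} \<subseteq> U" using R by blast
      have "seminorm_on X p" using P p by (auto simp: directed_seminorms_def)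
      then have "p (f - f) < e" using seminorm_zero[OF X, of p] p by simp
      then show "f \<in> \<Union>{V \<in> ?B. V \<subseteq> U}" using p f R by blast
    qed
    show "\<Union>{V \<in> ?B. V \<subseteq> U} \<subseteq> U" by (rule Union_least) simp
  qed
  moreover have "generate_topology_on ?B (\<Union>{V \<in> ?B. V \<subseteq> U})"
    by (intro generate_topology_on.UN generate_topology_on.Basis) (rule conjunct1, erule CollectD)
  ultimately show "openin (seminorm_topology X P) U"
    unfolding seminorm_topology_def openin_topology_generated_by_iff by simp
qed

lemma topspace_seminorm_topology:
  assumes "linear_subspace X" "directed_seminorms X P"
  shows "topspace (seminorm_topology X P) = X"
proof -
  obtain p where "p \<in> P" using assms by (auto simp: directed_seminorms_def)
  then have "openin (seminorm_topology X P) X"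
    using zero_less_one by (subst openin_seminorm_topology[OF assms]) blast
  moreover have "topspace (seminorm_topology X P) \<subseteq> X"
    using iffD1[OF openin_seminorm_topology[OF assms] openin_topspace] by blast
  ultimately show ?thesis using openin_subset by blast
qed

text \<open>If the unit ball of \<open>p\<close> is open for \<open>Q\<close>, it contains a ball of one \<open>q\<close>, and homogeneity gives a
  linear estimate; conversely, such estimates put balls inside balls around every point. Hence
  every question below about topologies becomes one about inequalities between seminorms.\<close>
lemma seminorm_topology_le_iff:
  assumes X: "linear_subspace X" and P: "directed_seminorms X P" and Q: "directed_seminorms X Q"
  shows "(\<forall>U. openin (seminorm_topology X P) U \<longrightarrow> openin (seminorm_topology X Q) U) \<longleftrightarrow>
    (\<forall>p\<in>P. \<exists>q\<in>Q. \<exists>C. \<forall>f\<in>X. p f \<le> C * q f)"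
proof (intro iffI ballI allI impI)
  fix p assume le: "\<forall>U. openin (seminorm_topology X P) U \<longrightarrow> openin (seminorm_topology X Q) U"
    and p: "p \<in> P"
  have sp: "seminorm_on X p" using P p by (auto simp: directed_seminorms_def)
  have "openin (seminorm_topology X P) {g \<in> X. p (g - 0) < 1}"
    unfolding seminorm_topology_def using p linear_subspaceD(1)[OF X] zero_less_one
    by (intro topology_generated_by_Basis) blast
  then have "openin (seminorm_topology X Q) {g \<in> X. p (g - 0) < 1}" using le by blast
  moreover have "0 \<in> {g \<in> X. p (g - 0) < 1}"
    using seminorm_zero[OF X sp] linear_subspaceD(1)[OF X] by simp
  ultimately obtain q e where q: "q \<in> Q" "0 < e" "{g \<in> X. q (g - 0) < e} \<subseteq> {g \<in> X. p (g - 0) < 1}"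
    using openin_seminorm_topology[OF X Q] by meson
  have sq: "seminorm_on X q" using Q q by (auto simp: directed_seminorms_def)
  have "p f \<le> (2 * 1 / e) * q f" if "f \<in> X" for f
    using q(3) that by (intro seminorm_bound_of_ball[OF X sp sq \<open>0 < e\<close>]) (force intro: less_imp_le)+
  then show "\<exists>q\<in>Q. \<exists>C. \<forall>f\<in>X. p f \<le> C * q f" using q(1) by blast
next
  fix U assume dom: "\<forall>p\<in>P. \<exists>q\<in>Q. \<exists>C. \<forall>f\<in>X. p f \<le> C * q f"
    and U: "openin (seminorm_topology X P) U"
  have "\<exists>q\<in>Q. \<exists>e>0. {g \<in> X. q (g - f) < e} \<subseteq> U" if f: "f \<in> U" for f
  proof -
    obtain p e where p: "p \<in> P" "0 < e" "{g \<in> X. p (g - f) < e} \<subseteq> U" and UX: "U \<subseteq> X"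
      using U f openin_seminorm_topology[OF X P] by meson
    obtain q C where q: "q \<in> Q" "\<forall>f\<in>X. p f \<le> C * q f" using dom p by blast
    have sq: "seminorm_on X q" using Q q by (auto simp: directed_seminorms_def)
    have "p (g - f) < e" if "g \<in> X" "q (g - f) < e / (\<bar>C\<bar> + 1)" for g
    proof -
      have gf: "g - f \<in> X" using that f UX linear_subspaceD(4)[OF X] by auto
      have "p (g - f) \<le> C * q (g - f)" using q gf by blast
      also have "\<dots> \<le> (\<bar>C\<bar> + 1) * q (g - f)"
        using seminorm_onD(1)[OF sq gf] by (intro mult_right_mono) auto
      also have "\<dots> < e" using that(2) by (simp add: pos_less_divide_eq mult.commute)
      finally show ?thesis .
    qed
    then have "{g \<in> X. q (g - f) < e / (\<bar>C\<bar> + 1)} \<subseteq> U" using p(3) by blast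
    moreover have "0 < e / (\<bar>C\<bar> + 1)" using p(2) by simp
    ultimately show ?thesis using q(1) by blast
  qed
  moreover have "U \<subseteq> X" using U openin_seminorm_topology[OF X P] by meson
  ultimately show "openin (seminorm_topology X Q) U" using openin_seminorm_topology[OF X Q] by meson
qed

lemma coarser_seminorm_topology_iff:
  assumes "linear_subspace X" "directed_seminorms X P" "directed_seminorms X Q"
  shows "coarser (seminorm_topology X P) (seminorm_topology X Q) \<longleftrightarrow>
    (\<forall>p\<in>P. \<exists>q\<in>Q. \<exists>C. \<forall>f\<in>X. p f \<le> C * q f)"
  unfolding coarser_def seminorm_topology_le_iff[OF assms]
  by (simp add: topspace_seminorm_topology[OF assms(1,2)] topspace_seminorm_topology[OF assms(1,3)])

lemma seminorm_topology_eq_iff: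
  assumes "linear_subspace X" "directed_seminorms X P" "directed_seminorms X Q"
  shows "seminorm_topology X P = seminorm_topology X Q \<longleftrightarrow>
    (\<forall>p\<in>P. \<exists>q\<in>Q. \<exists>C. \<forall>f\<in>X. p f \<le> C * q f) \<and> (\<forall>q\<in>Q. \<exists>p\<in>P. \<exists>C. \<forall>f\<in>X. q f \<le> C * p f)"
  unfolding seminorm_topology_le_iff[OF assms, symmetric]
    seminorm_topology_le_iff[OF assms(1,3,2), symmetric] topology_eq by metis

text \<open>A set open for the restricted seminorms is the trace of the union of the balls of the larger space
  centred at its own points. Balls centred elsewhere yield nothing new: around each point of its
  trace, such a ball contains one centred at that point.\<close>
lemma subtopology_seminorm_topology:
  assumes Y: "linear_subspace Y" and P: "directed_seminorms Y P" and X: "linear_subspace X" "X \<subseteq> Y"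
  shows "subtopology (seminorm_topology Y P) X = seminorm_topology X P"
proof -
  have PX: "directed_seminorms X P"
    using P X(2) seminorm_on_subset[OF _ X(2)] unfolding directed_seminorms_def by blast
  show ?thesis
    unfolding topology_eq openin_subtopology
  proof (intro allI iffI)
    fix U assume "\<exists>T. openin (seminorm_topology Y P) T \<and> U = T \<inter> X"
    then obtain T where T: "openin (seminorm_topology Y P) T" "U = T \<inter> X" by blast
    have "\<exists>p\<in>P. \<exists>e>0. {g \<in> X. p (g - f) < e} \<subseteq> U" if f: "f \<in> U" for f
    proof -
      obtain p e where "p \<in> P" "0 < e" "{g \<in> Y. p (g - f) < e} \<subseteq> T"
        using T(2) f iffD1[OF openin_seminorm_topology[OF Y P] T(1)] by blast
      then show ?thesis using X(2) T(2) by blast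
    qed
    then show "openin (seminorm_topology X P) U"
      using T(2) openin_seminorm_topology[OF X(1) PX] by auto
  next
    fix U assume U: "openin (seminorm_topology X P) U"
    define \<B> where "\<B> = {{g \<in> Y. p (g - f) < e} | p f e. p \<in> P \<and> f \<in> U \<and> 0 < e \<and> {g \<in> X. p (g - f) < e} \<subseteq> U}"
    have UX: "U \<subseteq> X" using U openin_seminorm_topology[OF X(1) PX] by meson
    have "openin (seminorm_topology Y P) B" if "B \<in> \<B>" for B
      using that UX X(2) unfolding \<B>_def seminorm_topology_def
      by (intro topology_generated_by_Basis) blast
    then have "openin (seminorm_topology Y P) (\<Union>\<B>)" by blast
    moreover have "U = \<Union>\<B> \<inter> X"
    proof
      show "\<Union>\<B> \<inter> X \<subseteq> U" using X(2) unfolding \<B>_def by blast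
      show "U \<subseteq> \<Union>\<B> \<inter> X"
      proof
        fix f assume f: "f \<in> U"
        then obtain p e where p: "p \<in> P" "0 < e" "{g \<in> X. p (g - f) < e} \<subseteq> U"
          using iffD1[OF openin_seminorm_topology[OF X(1) PX] U] by blast
        have "seminorm_on X p" using PX p by (auto simp: directed_seminorms_def)
        then have "p (f - f) < e" using seminorm_zero[OF X(1), of p] p by simp
        then have "f \<in> {g \<in> Y. p (g - f) < e}" using f UX X(2) by blast
        moreover have "{g \<in> Y. p (g - f) < e} \<in> \<B>" using p f unfolding \<B>_def by blast
        ultimately show "f \<in> \<Union>\<B> \<inter> X" using f UX by blast
      qed
    qed
    ultimately show "\<exists>T. openin (seminorm_topology Y P) T \<and> U = T \<inter> X" by blast
  qed
qed

section \<open>Continuity of closable seminorms on Banach spaces\<close>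

lemma banach_onD:
  assumes "banach_on X p"
  shows "seminorm_on X p" "\<And>f. f \<in> X \<Longrightarrow> p f = 0 \<Longrightarrow> f = 0"
  using assms by (auto simp: banach_on_def norm_on_iff_seminorm)

text \<open>The sets \<open>{f. q f \<le> k}\<close> cover the complete space, so by the Baire category theorem the closure of
  one of them contains a ball; differences of its elements approximate everything near \<open>0\<close>.
  Since \<open>q\<close> need not be lower semicontinuous for \<open>p\<close>, the closure cannot be dropped here.\<close>
lemma banach_nearly_open:
  assumes X: "linear_subspace X" and ban: "banach_on X p" and q: "seminorm_on X q"
  obtains r where "0 < r"
    "\<And>f e. f \<in> X \<Longrightarrow> p f < r \<Longrightarrow> 0 < e \<Longrightarrow> \<exists>g\<in>X. q g \<le> 1 \<and> p (f - g) < e"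
proof -
  note p = banach_onD(1)[OF ban]
  note diff = linear_subspaceD(4)[OF X] and add = linear_subspaceD(2)[OF X]
    and scale = linear_subspaceD(3)[OF X]
  define d where "d f g = (if f \<in> X \<and> g \<in> X then p (f - g) else 0)" for f g
  interpret Metric_space X d
  proof
    show "0 \<le> d f g" for f g using seminorm_onD(1)[OF p] diff by (auto simp: d_def)
    show "d f g = d g f" for f g using seminorm_minus_commute[OF X p] by (auto simp: d_def)
    show "d f g = 0 \<longleftrightarrow> f = g" if "f \<in> X" "g \<in> X" for f g
      using banach_onD(2)[OF ban diff[OF that]] seminorm_zero[OF X p] that by (auto simp: d_def)
    show "d f h \<le> d f g + d g h" if "f \<in> X" "g \<in> X" "h \<in> X" for f g h
      using seminorm_triangle[OF X p that] that by (simp add: d_def)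
  qed
  have "mcomplete"
    unfolding mcomplete_def
  proof (intro allI impI)
    fix \<sigma> assume \<sigma>: "MCauchy \<sigma>"
    then have sX: "range \<sigma> \<subseteq> X" by (simp add: MCauchy_def)
    have "\<forall>e>0. \<exists>N. \<forall>m\<ge>N. \<forall>n\<ge>N. p (\<sigma> m - \<sigma> n) < e"
    proof (intro allI impI)
      fix e :: real assume "0 < e"
      then obtain N where N: "\<forall>n n'. N \<le> n \<longrightarrow> N \<le> n' \<longrightarrow> d (\<sigma> n) (\<sigma> n') < e"
        using \<sigma> unfolding MCauchy_def by blast
      have "d (\<sigma> m) (\<sigma> n) = p (\<sigma> m - \<sigma> n)" for m n using sX by (auto simp: d_def)
      then show "\<exists>N. \<forall>m\<ge>N. \<forall>n\<ge>N. p (\<sigma> m - \<sigma> n) < e" using N by metis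
    qed
    then obtain g where g: "g \<in> X" "(\<lambda>n. p (\<sigma> n - g)) \<longlonglongrightarrow> 0"
      using ban sX unfolding banach_on_def by blast
    have "d (\<sigma> n) g = p (\<sigma> n - g)" for n using sX g(1) by (auto simp: d_def)
    then have "limitin mtopology \<sigma> g sequentially"
      using g sX unfolding limitin_metric_dist_null by (auto simp: image_subset_iff)
    then show "\<exists>x. limitin mtopology \<sigma> x sequentially" by blast
  qed
  define V where "V n = {f \<in> X. q f \<le> real (Suc n)}" for n
  have "\<exists>n. mtopology interior_of (mtopology closure_of V n) \<noteq> {}"
  proof (rule ccontr)
    assume "\<nexists>n. mtopology interior_of (mtopology closure_of V n) \<noteq> {}"
    then have "mtopology interior_of \<Union>(range (\<lambda>n. mtopology closure_of V n)) = {}"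
      using \<open>mcomplete\<close> by (intro metric_Baire_category_alt) auto
    moreover have "X \<subseteq> \<Union>(range (\<lambda>n. mtopology closure_of V n))"
    proof
      fix f assume f: "f \<in> X"
      obtain n where "q f \<le> real n" using real_arch_simple by blast
      then have "f \<in> V n" using f by (simp add: V_def)
      moreover have "V n \<subseteq> mtopology closure_of V n"
        by (intro closure_of_subset) (auto simp: V_def)
      ultimately show "f \<in> \<Union>(range (\<lambda>n. mtopology closure_of V n))" by blast
    qed
    ultimately have "X \<subseteq> {}"
      by (metis interior_of_maximal openin_topspace topspace_mtopology)
    then show False using linear_subspaceD(1)[OF X] by blast
  qed
  then obtain n f0 where f0: "f0 \<in> mtopology interior_of (mtopology closure_of V n)" by blast
  then obtain s where s: "0 < s" "mball f0 s \<subseteq> mtopology closure_of V n"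
    by (meson interior_of_subset openin_interior_of openin_mtopology subset_trans)
  have f0X: "f0 \<in> X"
    using f0 interior_of_subset_topspace[of mtopology] by auto
  have approx: "\<exists>g\<in>V n. p (f - g) < e" if f: "f \<in> X" "p (f - f0) < s" and e: "0 < e" for f e
  proof -
    have "f \<in> mball f0 s"
      using f f0X seminorm_minus_commute[OF X p] by (simp add: d_def)
    then have "f \<in> mtopology closure_of V n" using s(2) by blast
    then obtain g where "g \<in> V n" "g \<in> mball f e" using e unfolding metric_closure_of by blast
    then show ?thesis by (auto simp: d_def)
  qed
  define k where "k = 2 * real (Suc n)"
  have k: "0 < k" by (simp add: k_def)
  show ?thesis
  proof (rule that[of "s / k"])
    show "0 < s / k" using s(1) k by simp
    fix f e assume f: "f \<in> X" "p f < s / k" and e: "0 < (e::real)"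
    \<comment> \<open>Approximate both \<open>f0 + k f\<close> and \<open>f0\<close>; the difference of the approximants, divided by \<open>k\<close>,
      is the required function.\<close>
    define h where "h = (\<lambda>z. of_real k * f z)"
    have h: "h \<in> X" "p h < s"
      using scale[OF f(1)] seminorm_onD(2)[OF p f(1), of "of_real k"] f(2) k
      by (auto simp: h_def field_simps)
    have f0p: "p (f0 - f0) < s" using seminorm_zero[OF X p] s(1) by simp
    have ek: "0 < e * k / 2" using e k by simp
    obtain g1 where g1: "g1 \<in> V n" "p (f0 + h - g1) < e * k / 2"
      using approx[OF add[OF f0X h(1)] _ ek] h(2) by auto
    obtain g2 where g2: "g2 \<in> V n" "p (f0 - g2) < e * k / 2"
      using approx[OF f0X f0p ek] by auto
    have gX: "g1 \<in> X" "g2 \<in> X" using g1 g2 by (auto simp: V_def)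
    define g where "g = (\<lambda>z. of_real (1 / k) * (g1 - g2) z)"
    have "q (g1 - g2) \<le> q (g1 - 0) + q (0 - g2)"
      using seminorm_triangle[OF X q gX(1) linear_subspaceD(1)[OF X] gX(2)] .
    also have "q (0 - g2) = q (g2 - 0)"
      using seminorm_minus_commute[OF X q linear_subspaceD(1)[OF X] gX(2)] .
    also have "q (g1 - 0) + q (g2 - 0) \<le> k" using g1 g2 by (simp add: V_def k_def)
    finally have "q (g1 - g2) \<le> k" .
    moreover have "q g = q (g1 - g2) / k"
      using seminorm_onD(2)[OF q diff[OF gX], of "of_real (1 / k)"] k unfolding g_def
      by (simp add: norm_divide)
    ultimately have "q g \<le> 1" using k by simp
    have "p (h - (g1 - g2)) = p ((f0 + h - g1) - (f0 - g2))" by (simp add: algebra_simps)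
    also have "\<dots> \<le> p ((f0 + h - g1) - 0) + p (0 - (f0 - g2))"
      by (intro seminorm_triangle[OF X p] diff add linear_subspaceD(1)[OF X] f0X h(1) gX)
    also have "p (0 - (f0 - g2)) = p ((f0 - g2) - 0)"
      using seminorm_minus_commute[OF X p linear_subspaceD(1)[OF X] diff[OF f0X gX(2)]] .
    also have "p ((f0 + h - g1) - 0) + p ((f0 - g2) - 0) < e * k" using g1 g2 by simp
    finally have *: "p (h - (g1 - g2)) < e * k" .
    have "f - g = (\<lambda>z. of_real (1 / k) * (h - (g1 - g2)) z)"
      using k by (auto simp: fun_eq_iff g_def h_def field_simps)
    then have "p (f - g) = p (h - (g1 - g2)) / k"
      using seminorm_onD(2)[OF p diff[OF h(1) diff[OF gX]], of "of_real (1 / k)"] k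
      by (simp add: norm_divide)
    then have "p (f - g) < e" using * k by (simp only: pos_divide_less_eq)
    moreover have "g \<in> X" unfolding g_def using scale[OF diff[OF gX]] .
    ultimately show "\<exists>g\<in>X. q g \<le> 1 \<and> p (f - g) < e" using \<open>q g \<le> 1\<close> by blast
  qed
qed

text \<open>This is the closed graph theorem for the identity map from a Banach space into a space with
  countably many seminorms. A small \<open>f\<close> is approximated repeatedly by the preceding lemma, with the
  errors measured by \<open>p\<close> and with the \<open>n\<close>-th correction small for \<open>q (k + n)\<close>. Because the index
  grows along the construction, the partial sums are Cauchy for every \<open>q l\<close>, and
  closability identifies their limit with \<open>f\<close> itself.\<close>
lemma banach_dominates_closable_seminorms:
  fixes q :: "nat \<Rightarrow> (complex \<Rightarrow> complex) \<Rightarrow> real"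
  assumes X: "linear_subspace X" and ban: "banach_on X p" and q: "\<And>k. seminorm_on X (q k)"
    and mono: "\<And>k l f. f \<in> X \<Longrightarrow> k \<le> l \<Longrightarrow> q k f \<le> q l f"
    and closable: "\<And>f g k. \<lbrakk>range f \<subseteq> X; g \<in> X; (\<lambda>n. p (f n - g)) \<longlonglongrightarrow> 0;
      \<And>l e. 0 < e \<Longrightarrow> \<exists>N. \<forall>i\<ge>N. \<forall>j\<ge>N. q l (f i - f j) < e\<rbrakk> \<Longrightarrow> (\<lambda>n. q k (f n - g)) \<longlonglongrightarrow> 0"
  shows "\<exists>C. \<forall>f\<in>X. q k f \<le> C * p f"
proof -
  note p = banach_onD(1)[OF ban]
  note diff = linear_subspaceD(4)[OF X] and scale = linear_subspaceD(3)[OF X]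
  have "\<exists>r>0. \<forall>f\<in>X. \<forall>e>0. p f < r \<longrightarrow> (\<exists>g\<in>X. q l g \<le> 1 \<and> p (f - g) < e)" for l
    using banach_nearly_open[OF X ban q[of l]] by metis
  then obtain r where r: "\<And>l. 0 < (r l::real)"
    "\<And>l f e. f \<in> X \<Longrightarrow> 0 < e \<Longrightarrow> p f < r l \<Longrightarrow> \<exists>g\<in>X. q l g \<le> 1 \<and> p (f - g) < e"
    by metis
  have step: "\<exists>g\<in>X. q l g \<le> t \<and> p (f - g) < e"
    if f: "f \<in> X" "p f < t * r l" and "0 < t" "0 < e" for l f t e
  proof -
    have "p (\<lambda>z. of_real (1 / t) * f z) = p f / t"
      using seminorm_onD(2)[OF p f(1), of "of_real (1 / t)"] \<open>0 < t\<close> by (simp add: norm_divide)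
    then have "p (\<lambda>z. of_real (1 / t) * f z) < r l"
      using f(2) \<open>0 < t\<close> by (simp only: pos_divide_less_eq mult.commute)
    then obtain g where g: "g \<in> X" "q l g \<le> 1" "p ((\<lambda>z. of_real (1 / t) * f z) - g) < e / t"
      using r(2)[OF scale[OF f(1)], of "e / t"] \<open>0 < t\<close> \<open>0 < e\<close> by fastforce
    define h where "h = (\<lambda>z. of_real t * g z)"
    have "f - h = (\<lambda>z. of_real t * ((\<lambda>z. of_real (1 / t) * f z) - g) z)"
      using \<open>0 < t\<close> by (auto simp: fun_eq_iff h_def field_simps)
    then have "p (f - h) = t * p ((\<lambda>z. of_real (1 / t) * f z) - g)"
      using seminorm_onD(2)[OF p diff[OF scale[OF f(1), of "of_real (1 / t)"] g(1)], of "of_real t"]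
        \<open>0 < t\<close> by simp
    then have "p (f - h) < e" using g(3) \<open>0 < t\<close> by (simp add: field_simps)
    moreover have "q l h \<le> t"
      using seminorm_onD(2)[OF q g(1), of l "of_real t"] g(2) \<open>0 < t\<close> by (simp add: h_def)
    moreover have "h \<in> X" unfolding h_def using scale[OF g(1)] .
    ultimately show ?thesis by blast
  qed
  \<comment> \<open>The factor \<open>1/2\<close> makes the errors tend to \<open>0\<close>; \<open>r (k + n)\<close> lets the next approximation be small for
    \<open>q (k + n)\<close>.\<close>
  define \<delta> where "\<delta> n = (1/2)^n * min (r (k + n)) 1" for n
  have \<delta>: "0 < \<delta> n" "\<delta> n \<le> (1/2)^n" "\<delta> n \<le> (1/2)^n * r (k + n)" for n
    using r(1)[of "k + n"] by (auto simp: \<delta>_def intro: mult_left_le)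
  have small: "q k f \<le> 2" if f: "f \<in> X" "p f < \<delta> 0" for f
  proof -
    \<comment> \<open>\<open>h n\<close> is the error after \<open>n\<close> approximations, so \<open>h n - h (Suc n)\<close> is the next correction.\<close>
    have "\<exists>h. \<forall>n. (h n \<in> X \<and> p (h n) < \<delta> n \<and> (n = 0 \<longrightarrow> h n = f)) \<and>
        q (k + n) (h n - h (Suc n)) \<le> (1/2)^n"
    proof (rule dependent_nat_choice)
      show "\<exists>x. x \<in> X \<and> p x < \<delta> 0 \<and> (0 = (0::nat) \<longrightarrow> x = f)" using f by blast
      fix h and n :: nat assume "h \<in> X \<and> p h < \<delta> n \<and> (n = 0 \<longrightarrow> h = f)"
      then have h: "h \<in> X" "p h < (1/2)^n * r (k + n)" using \<delta>(3)[of n] by auto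
      then obtain g where g: "g \<in> X" "q (k + n) g \<le> (1/2)^n" "p (h - g) < \<delta> (Suc n)"
        using step[OF h _ \<delta>(1)[of "Suc n"]] by auto
      then have "h - g \<in> X \<and> p (h - g) < \<delta> (Suc n) \<and> q (k + n) (h - (h - g)) \<le> (1/2)^n"
        using diff[OF h(1) g(1)] by simp
      then show "\<exists>y. (y \<in> X \<and> p y < \<delta> (Suc n) \<and> (Suc n = 0 \<longrightarrow> y = f)) \<and>
          q (k + n) (h - y) \<le> (1/2)^n" by blast
    qed
    then obtain h where h: "\<And>n. h n \<in> X" "\<And>n. p (h n) < \<delta> n" "h 0 = f"
      "\<And>n. q (k + n) (h n - h (Suc n)) \<le> (1/2)^n" by blast
    have tail: "q l (h N - h (N + i)) \<le> 2 * (1/2)^N - 2 * (1/2)^(N + i)" if "l \<le> k + N" for l N i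
    proof (induction i)
      case 0
      show ?case using seminorm_zero[OF X q, of l] by (simp add: zero_fun_def)
    next
      case (Suc i)
      have "q l (h N - h (N + Suc i)) \<le> q l (h N - h (N + i)) + q l (h (N + i) - h (Suc (N + i)))"
        using seminorm_triangle[OF X q h(1) h(1) h(1)] by simp
      also have "q l (h (N + i) - h (Suc (N + i))) \<le> q (k + (N + i)) (h (N + i) - h (Suc (N + i)))"
        using that by (intro mono diff h(1)) simp
      also have "\<dots> \<le> (1/2)^(N + i)" using h(4)[of "N + i"] by (simp add: add.assoc)
      finally have "q l (h N - h (N + Suc i)) \<le> q l (h N - h (N + i)) + (1/2)^(N + i)" by linarith
      moreover have "(1/2::real)^(N + i) = 2 * (1/2)^(N + Suc i)" by simp
      ultimately show ?case using Suc.IH by linarith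
    qed
    define s where "s n = f - h n" for n
    have sX: "range s \<subseteq> X" using diff[OF f(1) h(1)] by (auto simp: s_def)
    have zero: "0 \<in> X" by (rule linear_subspaceD(1)[OF X])
    have s_f: "t (s n - f) = t (h n)" if "seminorm_on X t" for t n
    proof -
      have "s n - f = 0 - h n" by (simp add: s_def)
      then show ?thesis using seminorm_minus_commute[OF X that zero h(1)] by simp
    qed
    have "(\<lambda>n. p (h n)) \<longlonglongrightarrow> 0"
    proof (rule tendsto_sandwich)
      show "\<forall>\<^sub>F n in sequentially. 0 \<le> p (h n)" using seminorm_onD(1)[OF p h(1)] by simp
      show "\<forall>\<^sub>F n in sequentially. p (h n) \<le> (1/2)^n"
        using h(2) \<delta>(2) by (intro always_eventually allI) (meson less_imp_le order_trans)
      show "(\<lambda>n. (1/2)^n) \<longlonglongrightarrow> (0::real)" by (rule LIMSEQ_power_zero) simp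
    qed simp
    then have "(\<lambda>n. p (s n - f)) \<longlonglongrightarrow> 0" by (simp add: s_f[OF p])
    moreover have "\<exists>N. \<forall>i\<ge>N. \<forall>j\<ge>N. q l (s i - s j) < e" if "0 < e" for l e
    proof -
      have "0 < e / 4" "1/2 < (1::real)" using that by simp_all
      then obtain M where M: "(1/2)^M < e / 4" using real_arch_pow_inv by metis
      define N where "N = max M l"
      have N: "4 * (1/2)^N < e" "l \<le> k + N"
        using M power_decreasing[of M N "1/2::real"] unfolding N_def by linarith+
      have near: "q l (h N - h i) \<le> 2 * (1/2)^N" if "i \<ge> N" for i
        using tail[OF N(2), of "i - N"] that
        by (smt (verit) le_add_diff_inverse zero_le_power divide_nonneg_nonneg)
      have "q l (s i - s j) < e" if "i \<ge> N" "j \<ge> N" for i j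
      proof -
        have "s i - s j = h j - h i" by (simp add: s_def)
        then have "q l (s i - s j) \<le> q l (h j - h N) + q l (h N - h i)"
          using seminorm_triangle[OF X q h(1) h(1) h(1)] by simp
        also have "q l (h j - h N) = q l (h N - h j)" by (rule seminorm_minus_commute[OF X q h(1) h(1)])
        also have "q l (h N - h j) + q l (h N - h i) < e"
          using near[OF that(1)] near[OF that(2)] N(1) by simp
        finally show ?thesis .
      qed
      then show ?thesis by blast
    qed
    ultimately have "(\<lambda>n. q k (s n - f)) \<longlonglongrightarrow> 0" using closable[OF sX f(1)] by blast
    then have lim: "(\<lambda>n. 2 + q k (h n)) \<longlonglongrightarrow> 2 + 0" by (intro tendsto_intros) (simp add: s_f[OF q])
    have "q k f \<le> 2 + q k (h n)" for n
    proof -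
      have "q k (f - 0) \<le> q k (f - h n) + q k (h n - 0)"
        using seminorm_triangle[OF X q f(1) h(1) zero] .
      also have "q k (f - h n) \<le> 2"
        using tail[of k 0 n] h(3) by (smt (verit) add_0 power_0 zero_le_power divide_nonneg_nonneg le_add1)
      finally show ?thesis by simp
    qed
    then show ?thesis using LIMSEQ_le_const[OF lim] by auto
  qed
  have "q k f \<le> (2 * 2 / \<delta> 0) * p f" if "f \<in> X" for f
    using small by (intro seminorm_bound_of_ball[OF X q p \<delta>(1)] that) auto
  then show ?thesis by blast
qed

section \<open>Completeness of weighted spaces of holomorphic functions\<close>

lemma linear_subspace_holo: "linear_subspace (holo G)"
  by (auto simp: linear_subspace_def holo_def zero_fun_def plus_fun_def intro!: holomorphic_intros)

lemma Hv_subset_holo: "Hv G v \<subseteq> holo G"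
  by (auto simp: Hv_def)

lemma Hv_I:
  assumes "f \<in> holo G" "\<And>z. z \<in> G \<Longrightarrow> v z * cmod (f z) \<le> B"
  shows "f \<in> Hv G v"
  using assms by (auto simp: Hv_def bdd_above_def)

lemma Hv_D:
  assumes "f \<in> Hv G v"
  shows "\<exists>B. \<forall>z\<in>G. v z * cmod (f z) \<le> B"
  using assms by (auto simp: Hv_def bdd_above_def)

lemma linear_subspace_Hv:
  assumes "weight_on G v"
  shows "linear_subspace (Hv G v)"
  unfolding linear_subspace_def
proof (intro conjI ballI allI)
  note holo = linear_subspaceD[OF linear_subspace_holo[of G]]
  show "0 \<in> Hv G v" using holo(1) by (intro Hv_I[where B = 0]) auto
  fix f assume f: "f \<in> Hv G v"
  then obtain B where B: "\<And>z. z \<in> G \<Longrightarrow> v z * cmod (f z) \<le> B" using Hv_D by blast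
  show "(\<lambda>z. c * f z) \<in> Hv G v" for c
  proof (rule Hv_I)
    show "(\<lambda>z. c * f z) \<in> holo G" using f Hv_subset_holo holo(3) by blast
    show "v z * cmod (c * f z) \<le> cmod c * B" if "z \<in> G" for z
      using mult_left_mono[OF B[OF that], of "cmod c"] by (simp add: norm_mult mult_ac)
  qed
  fix g assume g: "g \<in> Hv G v"
  then obtain C where C: "\<And>z. z \<in> G \<Longrightarrow> v z * cmod (g z) \<le> C" using Hv_D by blast
  show "f + g \<in> Hv G v"
  proof (rule Hv_I)
    show "f + g \<in> holo G" using f g Hv_subset_holo holo(2) by blast
    show "v z * cmod ((f + g) z) \<le> B + C" if "z \<in> G" for z
    proof -
      have "v z * cmod (f z + g z) \<le> v z * (cmod (f z) + cmod (g z))"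
        using assms that by (intro mult_left_mono norm_triangle_ineq) (simp add: weight_on_def)
      then show ?thesis using B[OF that] C[OF that] by (simp add: distrib_left)
    qed
  qed
qed

lemma wnorm_ge: "f \<in> Hv G v \<Longrightarrow> z \<in> G \<Longrightarrow> v z * cmod (f z) \<le> wnorm G v f"
  unfolding wnorm_def Hv_def by (auto intro: cSUP_upper)

lemma wnorm_le:
  assumes "G \<noteq> {}" "\<And>z. z \<in> G \<Longrightarrow> v z * cmod (f z) \<le> B"
  shows "wnorm G v f \<le> B"
  unfolding wnorm_def using assms by (rule cSUP_least)

lemma seminorm_on_wnorm:
  assumes G: "G \<noteq> {}" and v: "weight_on G v"
  shows "seminorm_on (Hv G v) (wnorm G v)"
  unfolding seminorm_on_def
proof (intro conjI ballI allI)
  fix f assume f: "f \<in> Hv G v"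
  show "0 \<le> wnorm G v f"
    using G wnorm_ge[OF f] v unfolding weight_on_def
    by (metis all_not_in_conv mult_nonneg_nonneg norm_ge_zero order_trans)
  have le: "wnorm G v (\<lambda>z. c * f z) \<le> cmod c * wnorm G v f" if "f \<in> Hv G v" for c f
  proof (rule wnorm_le[OF G])
    show "v z * cmod (c * f z) \<le> cmod c * wnorm G v f" if "z \<in> G" for z
      using mult_left_mono[OF wnorm_ge[OF \<open>f \<in> Hv G v\<close> that], of "cmod c"]
      by (simp add: norm_mult mult_ac)
  qed
  show "wnorm G v (\<lambda>z. c * f z) = cmod c * wnorm G v f" for c
  proof (cases "c = 0")
    case True
    have "wnorm G v (\<lambda>z. 0) = 0" unfolding wnorm_def using G by simp
    then show ?thesis using True by simp
  next
    case False
    have "wnorm G v (\<lambda>z. inverse c * (c * f z)) \<le> cmod (inverse c) * wnorm G v (\<lambda>z. c * f z)"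
      using linear_subspaceD(3)[OF linear_subspace_Hv[OF v] f] by (rule le)
    then have "wnorm G v f \<le> wnorm G v (\<lambda>z. c * f z) / cmod c"
      using False by (simp add: norm_inverse divide_inverse mult.commute mult.assoc[symmetric])
    then show ?thesis using le[OF f, of c] False by (simp add: field_simps)
  qed
  fix g assume g: "g \<in> Hv G v"
  show "wnorm G v (f + g) \<le> wnorm G v f + wnorm G v g"
  proof (rule wnorm_le[OF G])
    fix z assume z: "z \<in> G"
    have "v z * cmod (f z + g z) \<le> v z * (cmod (f z) + cmod (g z))"
      using v z by (intro mult_left_mono norm_triangle_ineq) (simp add: weight_on_def)
    then show "v z * cmod ((f + g) z) \<le> wnorm G v f + wnorm G v g"
      using wnorm_ge[OF f z] wnorm_ge[OF g z] by (simp add: distrib_left)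
  qed
qed

lemma supnorm_ge:
  assumes "f \<in> holo G" "compact L" "L \<subseteq> G" "z \<in> L"
  shows "cmod (f z) \<le> supnorm L f"
proof -
  have "continuous_on L (\<lambda>z. cmod (f z))"
    using assms unfolding holo_def
    by (auto intro!: continuous_intros intro: holomorphic_on_imp_continuous_on continuous_on_subset)
  then have "bdd_above ((\<lambda>z. cmod (f z)) ` L)"
    using assms(2) by (intro bounded_imp_bdd_above compact_imp_bounded compact_continuous_image)
  then show ?thesis
    unfolding supnorm_def using assms(4) by (intro cSup_upper) auto
qed

lemma supnorm_le:
  assumes "0 \<le> B" "\<And>z. z \<in> L \<Longrightarrow> cmod (f z) \<le> B"
  shows "supnorm L f \<le> B"
  unfolding supnorm_def using assms by (intro cSup_least) auto

lemma supnorm_nonneg: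
  assumes "f \<in> holo G" "compact L" "L \<subseteq> G"
  shows "0 \<le> supnorm L f"
proof (cases "L = {}")
  case True
  then show ?thesis by (simp add: supnorm_def)
next
  case False
  then show ?thesis using supnorm_ge[OF assms] norm_ge_zero order_trans by blast
qed

lemma supnorm_mono:
  assumes "f \<in> holo G" "compact L'" "L \<subseteq> L'" "L' \<subseteq> G"
  shows "supnorm L f \<le> supnorm L' f"
  using assms by (intro supnorm_le supnorm_nonneg[of f G] supnorm_ge[of f G]) auto

lemma seminorm_on_supnorm:
  assumes L: "compact L" "L \<subseteq> G"
  shows "seminorm_on (holo G) (supnorm L)"
  unfolding seminorm_on_def
proof (intro conjI ballI allI)
  fix f assume f: "f \<in> holo G"
  show "0 \<le> supnorm L f" using supnorm_nonneg[OF f L] .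
  have le: "supnorm L (\<lambda>z. c * f z) \<le> cmod c * supnorm L f" if "f \<in> holo G" for c f
    using supnorm_ge[OF that L] supnorm_nonneg[OF that L]
    by (intro supnorm_le) (auto simp: norm_mult intro: mult_left_mono)
  show "supnorm L (\<lambda>z. c * f z) = cmod c * supnorm L f" for c
  proof (cases "c = 0")
    case True
    have "supnorm L (\<lambda>z. 0) \<le> 0" by (rule supnorm_le) auto
    moreover have "0 \<le> supnorm L (\<lambda>z. 0)"
      using supnorm_nonneg[OF _ L] linear_subspaceD(1)[OF linear_subspace_holo[of G]]
      by (simp add: zero_fun_def)
    ultimately show ?thesis using True by simp
  next
    case False
    have "supnorm L (\<lambda>z. inverse c * (c * f z)) \<le> cmod (inverse c) * supnorm L (\<lambda>z. c * f z)"
      using linear_subspaceD(3)[OF linear_subspace_holo f] by (rule le)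
    then have "supnorm L f \<le> supnorm L (\<lambda>z. c * f z) / cmod c"
      using False by (simp add: norm_inverse divide_inverse mult.commute mult.assoc[symmetric])
    then show ?thesis using le[OF f, of c] False by (simp add: field_simps)
  qed
  fix g assume g: "g \<in> holo G"
  have "cmod ((f + g) z) \<le> supnorm L f + supnorm L g" if "z \<in> L" for z
    using norm_triangle_ineq[of "f z" "g z"] supnorm_ge[OF f L that] supnorm_ge[OF g L that] by simp
  then show "supnorm L (f + g) \<le> supnorm L f + supnorm L g"
    using supnorm_nonneg[OF f L] supnorm_nonneg[OF g L] by (intro supnorm_le) auto
qed

lemma fundamental_sequenceD:
  assumes "fundamental_sequence G K"
  shows "compact (K n)" "K n \<subseteq> G" "m \<le> n \<Longrightarrow> K m \<subseteq> K n"
    "compact L \<Longrightarrow> L \<subseteq> G \<Longrightarrow> \<exists>n. L \<subseteq> K n"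
  using assms unfolding fundamental_sequence_def incseq_def by auto

text \<open>Uniform limits on small closed discs are holomorphic, and every compact set lies in some \<open>K n\<close>.\<close>
lemma holo_complete:
  fixes f :: "nat \<Rightarrow> complex \<Rightarrow> complex"
  assumes G: "open G" and K: "fundamental_sequence G K" and f: "range f \<subseteq> holo G"
    and Cauchy: "\<And>n e. 0 < e \<Longrightarrow> \<exists>N. \<forall>i\<ge>N. \<forall>j\<ge>N. supnorm (K n) (f i - f j) < e"
  obtains g where "g \<in> holo G" "\<And>L. compact L \<Longrightarrow> L \<subseteq> G \<Longrightarrow> (\<lambda>n. supnorm L (f n - g)) \<longlonglongrightarrow> 0"
proof -
  note KD = fundamental_sequenceD[OF K]
  have fh: "f i \<in> holo G" for i using f by auto
  have diff: "f i - f j \<in> holo G" for i j using linear_subspaceD(4)[OF linear_subspace_holo fh fh] .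
  have uC: "uniformly_Cauchy_on L f" if L: "compact L" "L \<subseteq> G" for L
  proof (rule uniformly_Cauchy_onI)
    fix e :: real assume "0 < e"
    obtain n where n: "L \<subseteq> K n" using KD(4)[OF L] by blast
    obtain N where N: "\<forall>i\<ge>N. \<forall>j\<ge>N. supnorm (K n) (f i - f j) < e" using Cauchy[OF \<open>0 < e\<close>] by blast
    have "dist (f i z) (f j z) < e" if "z \<in> L" "i \<ge> N" "j \<ge> N" for z i j
    proof -
      have "cmod ((f i - f j) z) \<le> supnorm (K n) (f i - f j)"
        using n that by (intro supnorm_ge[OF diff KD(1,2)]) auto
      then show ?thesis using N that by (fastforce simp: dist_norm)
    qed
    then show "\<exists>M. \<forall>z\<in>L. \<forall>m\<ge>M. \<forall>n\<ge>M. dist (f m z) (f n z) < e" by blast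
  qed
  define g where "g z = (if z \<in> G then lim (\<lambda>n. f n z) else 0)" for z
  have lim: "uniform_limit L f g sequentially" if L: "compact L" "L \<subseteq> G" for L
  proof -
    obtain h where h: "uniform_limit L f h sequentially"
      using Cauchy_uniformly_convergent[OF uC[OF L]] by (auto simp: uniformly_convergent_on_def)
    have "h z = g z" if "z \<in> L" for z
      using tendsto_uniform_limitI[OF h that] L(2) that by (auto simp: g_def limI)
    then show ?thesis using h uniform_limit_cong'[of L f f h g] by simp
  qed
  have g: "g \<in> holo G"
  proof -
    have "g holomorphic_on G"
    proof (rule holomorphic_uniform_sequence[OF G])
      show "f n holomorphic_on G" for n using fh by (simp add: holo_def)
      fix z assume "z \<in> G"
      then obtain d where "0 < d" "cball z d \<subseteq> G" using G open_contains_cball by blast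
      then show "\<exists>d. 0 < d \<and> cball z d \<subseteq> G \<and> uniform_limit (cball z d) f g sequentially"
        using lim[OF compact_cball] by blast
    qed
    then show ?thesis by (simp add: holo_def g_def)
  qed
  moreover have "(\<lambda>n. supnorm L (f n - g)) \<longlonglongrightarrow> 0" if L: "compact L" "L \<subseteq> G" for L
  proof (rule tendstoI)
    fix e :: real assume "0 < e"
    then have "\<forall>\<^sub>F n in sequentially. \<forall>z\<in>L. dist (f n z) (g z) < e / 2"
      using lim[OF L] half_gt_zero[OF \<open>0 < e\<close>] unfolding uniform_limit_iff by blast
    then show "\<forall>\<^sub>F n in sequentially. dist (supnorm L (f n - g)) 0 < e"
    proof eventually_elim
      case (elim n)
      have "supnorm L (f n - g) \<le> e / 2"
        using elim \<open>0 < e\<close> by (intro supnorm_le) (auto simp: dist_norm less_imp_le)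
      moreover have "0 \<le> supnorm L (f n - g)"
        using supnorm_nonneg[OF linear_subspaceD(4)[OF linear_subspace_holo fh g] L] .
      ultimately show ?case using \<open>0 < e\<close> by simp
    qed
  qed
  ultimately show ?thesis using that by blast
qed

lemma supnorm_tendsto_pointwise:
  fixes f :: "nat \<Rightarrow> complex \<Rightarrow> complex"
  assumes f: "\<And>n. f n \<in> holo G" and g: "g \<in> holo G" and z: "z \<in> G"
    and lim: "\<And>L. compact L \<Longrightarrow> L \<subseteq> G \<Longrightarrow> (\<lambda>n. supnorm L (f n - g)) \<longlonglongrightarrow> 0"
  shows "(\<lambda>n. f n z) \<longlonglongrightarrow> g z"
proof (rule LIM_zero_cancel, rule tendsto_norm_zero_cancel)
  show "(\<lambda>n. cmod (f n z - g z)) \<longlonglongrightarrow> 0"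
  proof (rule tendsto_sandwich[of "\<lambda>_. 0"])
    show "(\<lambda>n. supnorm {z} (f n - g)) \<longlonglongrightarrow> 0" using z by (intro lim) auto
    have "cmod ((f n - g) z) \<le> supnorm {z} (f n - g)" for n
      using z by (intro supnorm_ge[OF linear_subspaceD(4)[OF linear_subspace_holo f g]]) auto
    then show "\<forall>\<^sub>F n in sequentially. cmod (f n z - g z) \<le> supnorm {z} (f n - g)" by simp
  qed auto
qed

lemma wnorm_tendsto_pointwise:
  fixes f :: "nat \<Rightarrow> complex \<Rightarrow> complex"
  assumes v: "weight_on G v" and f: "\<And>n. f n \<in> Hv G v" and g: "g \<in> Hv G v" and z: "z \<in> G" "v z \<noteq> 0"
    and lim: "(\<lambda>n. wnorm G v (f n - g)) \<longlonglongrightarrow> 0"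
  shows "(\<lambda>n. f n z) \<longlonglongrightarrow> g z"
proof (rule LIM_zero_cancel, rule tendsto_norm_zero_cancel)
  have vz: "0 < v z" using v z by (force simp: weight_on_def)
  show "(\<lambda>n. cmod (f n z - g z)) \<longlonglongrightarrow> 0"
  proof (rule tendsto_sandwich[of "\<lambda>_. 0"])
    show "(\<lambda>n. wnorm G v (f n - g) / v z) \<longlonglongrightarrow> 0"
      using tendsto_divide[OF lim tendsto_const[of "v z"]] vz by simp
    have "v z * cmod ((f n - g) z) \<le> wnorm G v (f n - g)" for n
      using wnorm_ge[OF linear_subspaceD(4)[OF linear_subspace_Hv[OF v] f g] z(1)] .
    then show "\<forall>\<^sub>F n in sequentially. cmod (f n z - g z) \<le> wnorm G v (f n - g) / v z"
      using vz by (simp add: field_simps)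
  qed auto
qed

text \<open>Suppose the space is Banach. Convergence in the weighted seminorm and locally uniform
  convergence can only have limits that agree where \<open>v\<close> is positive, so their difference has
  weighted norm \<open>0\<close> and vanishes. The suprema over the \<open>K n\<close> are therefore closable, hence bounded.
  Conversely, if the suprema are dominated, a function of weighted norm \<open>0\<close> vanishes on every
  \<open>K n\<close>, and a Cauchy sequence converges locally uniformly to a holomorphic function that is also
  its limit in the weighted norm.\<close>
theorem banach_Hv_iff_dominates_supnorms:
  assumes G: "open G" "G \<noteq> {}" and v: "weight_on G v" and K: "fundamental_sequence G K"
  shows "banach_on (Hv G v) (wnorm G v) \<longleftrightarrow>
    (\<forall>n. \<exists>C. \<forall>f\<in>Hv G v. supnorm (K n) f \<le> C * wnorm G v f)"
proof
  note KD = fundamental_sequenceD[OF K]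
  note X = linear_subspace_Hv[OF v]
  assume ban: "banach_on (Hv G v) (wnorm G v)"
  show "\<forall>n. \<exists>C. \<forall>f\<in>Hv G v. supnorm (K n) f \<le> C * wnorm G v f"
  proof
    fix n
    show "\<exists>C. \<forall>f\<in>Hv G v. supnorm (K n) f \<le> C * wnorm G v f"
    proof (rule banach_dominates_closable_seminorms[OF X ban, where q = "\<lambda>n. supnorm (K n)"])
      show "seminorm_on (Hv G v) (supnorm (K k))" for k
        using seminorm_on_subset[OF seminorm_on_supnorm[OF KD(1,2)] Hv_subset_holo] .
      show "supnorm (K k) f \<le> supnorm (K l) f" if "f \<in> Hv G v" "k \<le> l" for k l f
        using that Hv_subset_holo[of G v] by (intro supnorm_mono[of f G] KD) auto
      fix f :: "nat \<Rightarrow> complex \<Rightarrow> complex" and g k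
      assume f: "range f \<subseteq> Hv G v" and g: "g \<in> Hv G v" and lim: "(\<lambda>n. wnorm G v (f n - g)) \<longlonglongrightarrow> 0"
        and C: "\<And>l e. 0 < e \<Longrightarrow> \<exists>N. \<forall>i\<ge>N. \<forall>j\<ge>N. supnorm (K l) (f i - f j) < e"
      have fh: "range f \<subseteq> holo G" using f Hv_subset_holo by blast
      obtain h where h: "h \<in> holo G"
        "\<And>L. compact L \<Longrightarrow> L \<subseteq> G \<Longrightarrow> (\<lambda>n. supnorm L (f n - h)) \<longlonglongrightarrow> 0"
        using holo_complete[OF G(1) K fh C] by blast
      \<comment> \<open>Both limits are pointwise limits where \<open>v\<close> is positive, and elsewhere the weighted
        seminorm does not see the difference.\<close>
      have zero: "v z * cmod ((g - h) z) = 0" if z: "z \<in> G" for z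
      proof (cases "v z = 0")
        case False
        have "(\<lambda>n. f n z) \<longlonglongrightarrow> g z"
          using f by (intro wnorm_tendsto_pointwise[OF v _ g z False lim]) auto
        moreover have "(\<lambda>n. f n z) \<longlonglongrightarrow> h z"
          using fh by (intro supnorm_tendsto_pointwise[OF _ h(1) z h(2)]) auto
        ultimately show ?thesis using LIMSEQ_unique by fastforce
      qed simp
      have "g - h \<in> holo G"
        using linear_subspaceD(4)[OF linear_subspace_holo _ h(1)] g Hv_subset_holo by blast
      then have gh: "g - h \<in> Hv G v" using zero by (intro Hv_I[where B = 0] eq_refl)
      have "wnorm G v (g - h) \<le> 0" using zero by (intro wnorm_le[OF G(2)] eq_refl)
      then have "wnorm G v (g - h) = 0"
        using seminorm_onD(1)[OF seminorm_on_wnorm[OF G(2) v] gh] by simp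
      then have "g = h" using banach_onD(2)[OF ban gh] by simp
      then show "(\<lambda>n. supnorm (K k) (f n - g)) \<longlonglongrightarrow> 0" using h(2)[OF KD(1,2)] by simp
    qed
  qed
next
  note KD = fundamental_sequenceD[OF K]
  note X = linear_subspace_Hv[OF v] and p = seminorm_on_wnorm[OF G(2) v]
  assume dom: "\<forall>n. \<exists>C. \<forall>f\<in>Hv G v. supnorm (K n) f \<le> C * wnorm G v f"
  have def: "f = 0" if f: "f \<in> Hv G v" "wnorm G v f = 0" for f
  proof
    fix z
    show "f z = 0 z"
    proof (cases "z \<in> G")
      case True
      then obtain n where n: "{z} \<subseteq> K n" using KD(4)[of "{z}"] by auto
      have "cmod (f z) \<le> supnorm (K n) f"
        using n f Hv_subset_holo by (intro supnorm_ge[OF _ KD(1,2)]) auto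
      also have "\<dots> \<le> 0" using dom f by fastforce
      finally show ?thesis by simp
    next
      case False
      then show ?thesis using f by (auto simp: Hv_def holo_def)
    qed
  qed
  have complete: "\<exists>g\<in>Hv G v. (\<lambda>n. wnorm G v (f n - g)) \<longlonglongrightarrow> 0"
    if f: "range f \<subseteq> Hv G v" and C: "\<forall>e>0. \<exists>N. \<forall>m\<ge>N. \<forall>n\<ge>N. wnorm G v (f m - f n) < e"
    for f :: "nat \<Rightarrow> complex \<Rightarrow> complex"
  proof -
    have fX: "f n \<in> Hv G v" for n using f by auto
    have fh: "f n \<in> holo G" for n using fX Hv_subset_holo by blast
    have "\<exists>N. \<forall>i\<ge>N. \<forall>j\<ge>N. supnorm (K n) (f i - f j) < e" if "0 < e" for n e
    proof -
      obtain D where D: "\<forall>f\<in>Hv G v. supnorm (K n) f \<le> D * wnorm G v f" using dom by blast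
      obtain N where N: "\<forall>i\<ge>N. \<forall>j\<ge>N. wnorm G v (f i - f j) < e / (\<bar>D\<bar> + 1)"
        using C \<open>0 < e\<close> by (metis abs_ge_zero add_nonneg_pos divide_pos_pos zero_less_one)
      have "supnorm (K n) (f i - f j) < e" if "i \<ge> N" "j \<ge> N" for i j
      proof -
        have fij: "f i - f j \<in> Hv G v" using linear_subspaceD(4)[OF X fX fX] .
        have "supnorm (K n) (f i - f j) \<le> D * wnorm G v (f i - f j)" using D fij by blast
        also have "\<dots> \<le> (\<bar>D\<bar> + 1) * wnorm G v (f i - f j)"
          using seminorm_onD(1)[OF p fij] by (intro mult_right_mono) auto
        also have "\<dots> < e" using N that by (simp add: pos_less_divide_eq mult.commute)
        finally show ?thesis .
      qed
      then show ?thesis by blast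
    qed
    then obtain h where h: "h \<in> holo G"
      "\<And>L. compact L \<Longrightarrow> L \<subseteq> G \<Longrightarrow> (\<lambda>n. supnorm L (f n - h)) \<longlonglongrightarrow> 0"
      using holo_complete[OF G(1) K, of f] fh by blast
    have close: "\<exists>N. \<forall>m\<ge>N. \<forall>z\<in>G. v z * cmod ((f m - h) z) \<le> e" if "0 < e" for e
    proof -
      obtain N where N: "\<forall>m\<ge>N. \<forall>n\<ge>N. wnorm G v (f m - f n) < e" using C \<open>0 < e\<close> by blast
      have "v z * cmod ((f m - h) z) \<le> e" if m: "m \<ge> N" and z: "z \<in> G" for m z
      proof (rule LIMSEQ_le_const2)
        show "(\<lambda>n. v z * cmod (f m z - f n z)) \<longlonglongrightarrow> v z * cmod ((f m - h) z)"
          using supnorm_tendsto_pointwise[OF fh h(1) z h(2)] by (auto intro!: tendsto_intros)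
        have "v z * cmod ((f m - f n) z) \<le> e" if "n \<ge> N" for n
          using wnorm_ge[OF linear_subspaceD(4)[OF X fX fX] z, of m n] N m that by fastforce
        then show "\<exists>N. \<forall>n\<ge>N. v z * cmod (f m z - f n z) \<le> e" by auto
      qed
      then show ?thesis by blast
    qed
    have fmh: "f m - h \<in> holo G" for m using linear_subspaceD(4)[OF linear_subspace_holo fh h(1)] .
    obtain m where "\<forall>z\<in>G. v z * cmod ((f m - h) z) \<le> 1" using close[of 1] by auto
    then have "f m - h \<in> Hv G v" using fmh by (intro Hv_I) auto
    then have "f m - (f m - h) \<in> Hv G v" using linear_subspaceD(4)[OF X fX] by blast
    then have hX: "h \<in> Hv G v" by simp
    have "(\<lambda>n. wnorm G v (f n - h)) \<longlonglongrightarrow> 0"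
    proof (rule LIMSEQ_I)
      fix e :: real assume "0 < e"
      then obtain N where N: "\<forall>m\<ge>N. \<forall>z\<in>G. v z * cmod ((f m - h) z) \<le> e / 2" using close[of "e / 2"] by auto
      have "norm (wnorm G v (f m - h) - 0) < e" if "m \<ge> N" for m
      proof -
        have "wnorm G v (f m - h) \<le> e / 2" using N that by (intro wnorm_le[OF G(2)]) auto
        then show ?thesis
          using seminorm_onD(1)[OF p linear_subspaceD(4)[OF X fX hX]] \<open>0 < e\<close> by simp
      qed
      then show "\<exists>N. \<forall>m\<ge>N. norm (wnorm G v (f m - h) - 0) < e" by blast
    qed
    then show ?thesis using hX by blast
  qed
  show "banach_on (Hv G v) (wnorm G v)"
    unfolding banach_on_def norm_on_iff_seminorm
    using p def complete seminorm_zero[OF X p] by blast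
qed

section \<open>Holomorphic functions with prescribed zeros\<close>

text \<open>The bound makes the product converge uniformly on compact subsets, absolutely at each point, so
  that it vanishes only where one of the factors does. It is the one satisfied by the \<open>n\<close>-th
  elementary factor at points of modulus at most one half.\<close>
lemma holomorphic_product_zeros:
  fixes F :: "nat \<Rightarrow> complex \<Rightarrow> complex"
  assumes G: "open G" and hol: "\<And>n. F n holomorphic_on G"
    and bound: "\<And>L. compact L \<Longrightarrow> L \<subseteq> G \<Longrightarrow>
      \<exists>N. \<forall>n\<ge>N. \<forall>z\<in>L. cmod (F n z - 1) \<le> 3 * (1/2) ^ Suc n"
  obtains h where "h holomorphic_on G" "\<And>z. z \<in> G \<Longrightarrow> h z = 0 \<longleftrightarrow> (\<exists>n. F n z = 0)"
proof -
  define P where "P N z = (\<Prod>n<N. F n z)" for N z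
  define h where "h z = (\<Prod>n. F n z)" for z
  have summ: "summable (\<lambda>n. 3 * (1/2::real) ^ Suc n)"
    unfolding summable_Suc_iff by (intro summable_mult) (simp add: summable_Suc_iff summable_geometric)
  have conv: "convergent_prod (\<lambda>n. F n z)" if z: "z \<in> G" for z
  proof -
    obtain N where "\<forall>n\<ge>N. cmod (F n z - 1) \<le> 3 * (1/2) ^ Suc n" using bound[of "{z}"] z by auto
    then have "summable (\<lambda>n. norm (F n z - 1))"
      by (intro summable_comparison_test[OF _ summ]) auto
    then show ?thesis
      using abs_convergent_prod_conv_summable abs_convergent_prod_imp_convergent_prod by blast
  qed
  have ulim: "uniform_limit L P h sequentially" if L: "compact L" "L \<subseteq> G" for L
  proof -
    obtain N where N: "\<forall>n\<ge>N. \<forall>z\<in>L. cmod (F n z - 1) \<le> 3 * (1/2) ^ Suc n" using bound[OF L] by blast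
    have "uniformly_convergent_on L P"
      unfolding P_def
    proof (rule uniformly_convergent_on_prod')
      show "uniformly_convergent_on L (\<lambda>N z. \<Sum>n<N. norm (F n z - 1))"
      proof (rule Weierstrass_m_test'_ev[OF _ summ])
        show "\<forall>\<^sub>F n in sequentially. \<forall>z\<in>L. norm (norm (F n z - 1)) \<le> 3 * (1/2) ^ Suc n"
          using N unfolding eventually_sequentially by auto
      qed
      show "continuous_on L (F n)" for n
        using hol L(2) holomorphic_on_imp_continuous_on holomorphic_on_subset by blast
    qed (rule L)
    then obtain g where g: "uniform_limit L P g sequentially" by (auto simp: uniformly_convergent_on_def)
    have "g z = h z" if z: "z \<in> L" for z
    proof (rule LIMSEQ_unique)
      show "(\<lambda>n. P (Suc n) z) \<longlonglongrightarrow> g z"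
        using tendsto_uniform_limitI[OF g z] by (rule LIMSEQ_Suc)
      show "(\<lambda>n. P (Suc n) z) \<longlonglongrightarrow> h z"
        using convergent_prod_LIMSEQ[OF conv] z L(2) unfolding P_def h_def lessThan_Suc_atMost by blast
    qed
    then show ?thesis using g uniform_limit_cong'[of L P P g h] by simp
  qed
  have "h holomorphic_on G"
  proof (rule holomorphic_uniform_sequence[OF G])
    show "P n holomorphic_on G" for n unfolding P_def by (intro holomorphic_intros hol)
    fix z assume "z \<in> G"
    then obtain d where "0 < d" "cball z d \<subseteq> G" using G open_contains_cball by blast
    then show "\<exists>d. 0 < d \<and> cball z d \<subseteq> G \<and> uniform_limit (cball z d) P h sequentially"
      using ulim[OF compact_cball] by blast
  qed
  moreover have "h z = 0 \<longleftrightarrow> (\<exists>n. F n z = 0)" if "z \<in> G" for z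
    using has_prod_eq_0_iff[OF convergent_prod_has_prod[OF conv[OF that]]] by (auto simp: h_def image_def)
  ultimately show ?thesis using that by blast
qed

lemma discrete_in_eq_sparse_in: "open G \<Longrightarrow> discrete_in G E \<longleftrightarrow> E sparse_in G"
  by (simp add: discrete_in_def sparse_in_open)

text \<open>Weierstrass products on an arbitrary open set. A zero \<open>a\<close> whose distance to the complement is less
  than \<open>1 / cmod a\<close> is produced by the elementary factor at \<open>(a - b) / (z - b)\<close>, where \<open>b\<close> is a nearest
  point of the complement, and any other zero \<open>a\<close> by the one at \<open>z / a\<close>. As the zeros leave every
  compact subset, those of the first kind have distance to the complement tending to \<open>0\<close>, and those
  of the second kind tend to infinity.\<close>
theorem holomorphic_with_prescribed_zeros:
  assumes G: "open G" and E: "E \<subseteq> G" "discrete_in G E"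
  obtains h where "h holomorphic_on G" "\<And>z. z \<in> G \<Longrightarrow> h z = 0 \<longleftrightarrow> z \<in> E"
proof (cases "finite E")
  case True
  show ?thesis
  proof (rule that)
    show "(\<lambda>z. \<Prod>a\<in>E. z - a) holomorphic_on G" by (intro holomorphic_intros)
    show "(\<Prod>a\<in>E. z - a) = 0 \<longleftrightarrow> z \<in> E" for z using True by auto
  qed
next
  case False
  have sparse: "E sparse_in G" using discrete_in_eq_sparse_in[OF G] E(2) by simp
  have "countable E" using sparse_imp_countable[OF G sparse] E(1) by (simp add: Int_absorb1)
  then obtain a where a: "bij_betw a (UNIV :: nat set) E"
    using False countable_infiniteE' by blast
  have aE: "a n \<in> E" for n using a by (auto simp: bij_betw_def)
  have leaves: "\<exists>N. \<forall>n\<ge>N. a n \<notin> L" if L: "compact L" "L \<subseteq> G" for L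
  proof -
    have "finite (L \<inter> E)" using sparse_in_compact_finite[OF sparse_in_subset[OF sparse L(2)] L(1)] .
    then have "finite (a -` (L \<inter> E))" using a by (intro finite_vimageI) (auto simp: bij_betw_def)
    then obtain N where "a -` (L \<inter> E) \<subseteq> {..<N}" using finite_nat_iff_bounded by blast
    then have "\<forall>n\<ge>N. a n \<notin> L" using aE by fastforce
    then show ?thesis by blast
  qed
  have "\<exists>b. G \<noteq> UNIV \<longrightarrow> b \<notin> G \<and> (\<forall>w. w \<notin> G \<longrightarrow> dist (a n) b \<le> dist (a n) w)" for n
  proof (cases "G = UNIV")
    case False
    then have "closed (- G)" "- G \<noteq> {}" using G by auto
    then show ?thesis using distance_attains_inf[of "- G" "a n"] by (metis ComplD ComplI)
  qed simp
  then obtain b where b: "\<And>n. G \<noteq> UNIV \<Longrightarrow> b n \<notin> G"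
    "\<And>n w. G \<noteq> UNIV \<Longrightarrow> w \<notin> G \<Longrightarrow> dist (a n) (b n) \<le> dist (a n) w" by metis
  define near where "near n \<longleftrightarrow> G \<noteq> UNIV \<and> cmod (a n) * dist (a n) (b n) < 1" for n
  \<comment> \<open>The case \<open>a n = 0\<close> occurs at most once, so its factor does not affect convergence.\<close>
  define F where "F n z = (if near n then weierstrass_factor n ((a n - b n) / (z - b n))
    else if a n = 0 then z else weierstrass_factor n (z / a n))" for n z
  have nz: "z - b n \<noteq> 0" if "near n" "z \<in> G" for n z using b(1) that by (auto simp: near_def)
  have zero: "F n z = 0 \<longleftrightarrow> z = a n" if "z \<in> G" for n z
    using nz[OF _ that] by (auto simp: F_def)
  have "F n holomorphic_on G" for n
    unfolding F_def using nz by (cases "near n"; cases "a n = 0") (auto intro!: holomorphic_intros)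
  moreover have "\<exists>N. \<forall>n\<ge>N. \<forall>z\<in>L. cmod (F n z - 1) \<le> 3 * (1/2) ^ Suc n"
    if L: "compact L" "L \<subseteq> G" for L
  proof -
    obtain R where R: "0 < R" "\<And>z. z \<in> L \<Longrightarrow> cmod z \<le> R"
      using compact_imp_bounded[OF L(1)] by (auto simp: bounded_pos)
    have "\<exists>d>0. \<forall>x\<in>L. \<forall>y\<in>- G. d \<le> dist x y"
      using L G by (intro separate_compact_closed) auto
    then obtain d where d: "0 < d" "\<And>z w. z \<in> L \<Longrightarrow> w \<notin> G \<Longrightarrow> d \<le> dist z w" by blast
    define \<epsilon> where "\<epsilon> = min (d / 2) (1 / (2 * R))"
    have \<epsilon>: "0 < \<epsilon>" "\<epsilon> \<le> d / 2" "\<epsilon> \<le> 1 / (2 * R)" using d(1) R(1) by (auto simp: \<epsilon>_def)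
    \<comment> \<open>A compact subset of \<open>G\<close>; points outside it are far out or close to the complement of \<open>G\<close>.\<close>
    define M where "M = cball 0 (1 / \<epsilon>) \<inter> (\<Inter>w\<in>- G. - ball w \<epsilon>)"
    have "compact M" unfolding M_def by (intro compact_Int_closed compact_cball closed_INT) auto
    moreover have "M \<subseteq> G"
    proof (rule subsetI, rule ccontr)
      fix x assume "x \<in> M" "x \<notin> G"
      then have "x \<in> - ball x \<epsilon>" unfolding M_def by blast
      then show False using \<epsilon>(1) by simp
    qed
    ultimately obtain N where N: "\<forall>n\<ge>N. a n \<notin> M" using leaves by blast
    have "cmod (F n z - 1) \<le> 3 * (1/2) ^ Suc n" if n: "n \<ge> N" and z: "z \<in> L" for n z
    proof -
      \<comment> \<open>Either \<open>a n\<close> is far out, or it is close to the complement of \<open>G\<close>; both ways the argument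
        of the elementary factor is at most one half.\<close>
      have aM: "cmod (a n) > 1 / \<epsilon> \<or> (\<exists>w. w \<notin> G \<and> dist w (a n) < \<epsilon>)"
        using N n by (auto simp: M_def not_le)
      have half: "cmod (weierstrass_factor n x - 1) \<le> 3 * (1/2) ^ Suc n" if x: "cmod x \<le> 1/2" for x
      proof -
        have "cmod (weierstrass_factor n x - 1) \<le> 3 * cmod x ^ Suc n"
          using weierstrass_factor_bound[OF x] .
        also have "\<dots> \<le> 3 * (1/2) ^ Suc n" using x by (intro mult_left_mono power_mono) auto
        finally show ?thesis .
      qed
      show ?thesis
      proof (cases "near n")
        case True
        then have G': "G \<noteq> UNIV" and lt: "cmod (a n) * dist (a n) (b n) < 1" by (auto simp: near_def)
        have "dist (a n) (b n) \<le> \<epsilon>"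
          using aM
        proof
          assume big: "cmod (a n) > 1 / \<epsilon>"
          show ?thesis
          proof (rule ccontr)
            assume "\<not> ?thesis"
            then have "1 / \<epsilon> * \<epsilon> \<le> cmod (a n) * dist (a n) (b n)"
              using big \<epsilon>(1) by (intro mult_mono) auto
            then show False using lt \<epsilon>(1) by simp
          qed
        next
          assume "\<exists>w. w \<notin> G \<and> dist w (a n) < \<epsilon>"
          then obtain w where "w \<notin> G" "dist w (a n) < \<epsilon>" by blast
          then show ?thesis using b(2)[OF G', of w n] by (simp add: dist_commute)
        qed
        then have "cmod (a n - b n) \<le> d / 2" using \<epsilon>(2) by (simp add: dist_norm)
        moreover have "d \<le> cmod (z - b n)" using d(2)[OF z b(1)[OF G']] by (simp add: dist_norm)
        ultimately have "cmod ((a n - b n) / (z - b n)) \<le> 1/2"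
          using d(1) by (auto simp: norm_divide divide_simps)
        then show ?thesis using half True by (simp add: F_def)
      next
        case False
        have "1 / \<epsilon> \<le> cmod (a n)"
          using aM
        proof
          assume "\<exists>w. w \<notin> G \<and> dist w (a n) < \<epsilon>"
          then obtain w where w: "w \<notin> G" "dist w (a n) < \<epsilon>" by blast
          then have G': "G \<noteq> UNIV" by auto
          have "1 \<le> cmod (a n) * dist (a n) (b n)" using False G' by (simp add: near_def)
          also have "\<dots> \<le> cmod (a n) * \<epsilon>"
            using b(2)[OF G' w(1), of n] w(2) by (intro mult_left_mono) (auto simp: dist_commute)
          finally show ?thesis using \<epsilon>(1) by (simp add: field_simps)
        qed simp
        moreover have "2 * R \<le> 1 / \<epsilon>" using \<epsilon> R(1) by (simp add: field_simps)
        ultimately have an: "2 * R \<le> cmod (a n)" by simp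
        then have "a n \<noteq> 0" using R(1) by auto
        moreover have "cmod (z / a n) \<le> 1/2"
          using R(1) R(2)[OF z] an by (auto simp: norm_divide divide_simps)
        ultimately show ?thesis using half False by (simp add: F_def)
      qed
    qed
    then show ?thesis by blast
  qed
  ultimately obtain h where h: "h holomorphic_on G" "\<And>z. z \<in> G \<Longrightarrow> h z = 0 \<longleftrightarrow> (\<exists>n. F n z = 0)"
    using holomorphic_product_zeros[OF G] by metis
  have "h z = 0 \<longleftrightarrow> z \<in> E" if "z \<in> G" for z
    using h(2)[OF that] zero[OF that] a by (auto simp: bij_betw_def)
  then show ?thesis using that h(1) by blast
qed

section \<open>Comparison of the topologies\<close>

lemma wnorm_nonneg: "G \<noteq> {} \<Longrightarrow> weight_on G v \<Longrightarrow> f \<in> Hv G v \<Longrightarrow> 0 \<le> wnorm G v f"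
  using seminorm_onD(1)[OF seminorm_on_wnorm] by blast

lemma directed_seminorms_tau:
  assumes G: "G \<noteq> {}" and v: "weight_on G v" and K: "fundamental_sequence G K"
  shows "directed_seminorms (Hv G v) (range (\<lambda>n f. supnorm (K n) f + wnorm G v f))"
proof -
  note KD = fundamental_sequenceD[OF K]
  have "seminorm_on (Hv G v) (\<lambda>f. supnorm (K n) f + wnorm G v f)" for n
    using seminorm_on_subset[OF seminorm_on_supnorm[OF KD(1,2)] Hv_subset_holo]
    by (intro seminorm_on_add seminorm_on_wnorm[OF G v])
  moreover have "\<exists>k. \<forall>f\<in>Hv G v. supnorm (K m) f + wnorm G v f \<le> supnorm (K k) f + wnorm G v f \<and>
      supnorm (K n) f + wnorm G v f \<le> supnorm (K k) f + wnorm G v f" for m n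
    using Hv_subset_holo[of G v]
    by (intro exI[of _ "max m n"] ballI conjI add_right_mono supnorm_mono[of _ G] KD) auto
  ultimately show ?thesis by (auto simp: directed_seminorms_def)
qed

lemma directed_seminorms_supnorm:
  "directed_seminorms (holo G) {supnorm L | L. compact L \<and> L \<subseteq> G}"
  unfolding directed_seminorms_def
proof (intro conjI ballI)
  show "{supnorm L | L. compact L \<and> L \<subseteq> G} \<noteq> {}" by blast
  fix p assume "p \<in> {supnorm L | L. compact L \<and> L \<subseteq> G}"
  then obtain L where L: "p = supnorm L" "compact L" "L \<subseteq> G" by blast
  show "seminorm_on (holo G) p" using seminorm_on_supnorm[OF L(2,3)] L(1) by simp
  fix q assume "q \<in> {supnorm L | L. compact L \<and> L \<subseteq> G}"
  then obtain M where M: "q = supnorm M" "compact M" "M \<subseteq> G" by blast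
  have "\<forall>f\<in>holo G. p f \<le> supnorm (L \<union> M) f \<and> q f \<le> supnorm (L \<union> M) f"
    using L M by (auto intro!: supnorm_mono[of _ G])
  moreover have "supnorm (L \<union> M) \<in> {supnorm L | L. compact L \<and> L \<subseteq> G}" using L M by blast
  ultimately show "\<exists>r\<in>{supnorm L | L. compact L \<and> L \<subseteq> G}. \<forall>f\<in>holo G. p f \<le> r f \<and> q f \<le> r f"
    by blast
qed

text \<open>Domination of \<open>supnorm (K n) f + wnorm G v f\<close> by \<open>wnorm G v f\<close> is domination of the first
  summand, which characterises completeness.\<close>
lemma coarser_tau_tau_v_iff_banach:
  assumes G: "open G" "G \<noteq> {}" and v: "weight_on G v" and K: "fundamental_sequence G K"
  shows "coarser (tau G v K) (tau_v G v) \<longleftrightarrow> banach_on (Hv G v) (wnorm G v)"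
proof -
  have "(\<exists>C. \<forall>f\<in>Hv G v. supnorm (K n) f + wnorm G v f \<le> C * wnorm G v f) \<longleftrightarrow>
      (\<exists>C. \<forall>f\<in>Hv G v. supnorm (K n) f \<le> C * wnorm G v f)" (is "?A \<longleftrightarrow> ?B") for n
  proof
    assume ?A
    then obtain C where "\<forall>f\<in>Hv G v. supnorm (K n) f + wnorm G v f \<le> C * wnorm G v f" by blast
    then have "\<forall>f\<in>Hv G v. supnorm (K n) f \<le> (C - 1) * wnorm G v f" by (auto simp: algebra_simps)
    then show ?B by blast
  next
    assume ?B
    then obtain C where "\<forall>f\<in>Hv G v. supnorm (K n) f \<le> C * wnorm G v f" by blast
    then have "\<forall>f\<in>Hv G v. supnorm (K n) f + wnorm G v f \<le> (C + 1) * wnorm G v f"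
      by (auto simp: algebra_simps)
    then show ?A by blast
  qed
  then show ?thesis
    unfolding tau_def tau_v_def banach_Hv_iff_dominates_supnorms[OF assms]
      coarser_seminorm_topology_iff[OF linear_subspace_Hv[OF v] directed_seminorms_tau[OF G(2) v K]
        directed_seminorms_singleton[OF seminorm_on_wnorm[OF G(2) v]]]
    by simp
qed

lemma tau_eq_tau_v_iff_coarser:
  assumes G: "G \<noteq> {}" and v: "weight_on G v" and K: "fundamental_sequence G K"
  shows "tau G v K = tau_v G v \<longleftrightarrow> coarser (tau G v K) (tau_v G v)"
proof -
  note KD = fundamental_sequenceD[OF K]
  have "wnorm G v f \<le> 1 * (supnorm (K 0) f + wnorm G v f)" if "f \<in> Hv G v" for f
    using supnorm_nonneg[OF _ KD(1,2), of f 0] that Hv_subset_holo by auto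
  then have "\<exists>n C. \<forall>f\<in>Hv G v. wnorm G v f \<le> C * (supnorm (K n) f + wnorm G v f)" by metis
  then show ?thesis
    unfolding tau_def tau_v_def
      coarser_seminorm_topology_iff[OF linear_subspace_Hv[OF v] directed_seminorms_tau[OF G v K]
        directed_seminorms_singleton[OF seminorm_on_wnorm[OF G v]]]
      seminorm_topology_eq_iff[OF linear_subspace_Hv[OF v] directed_seminorms_tau[OF G v K]
        directed_seminorms_singleton[OF seminorm_on_wnorm[OF G v]]]
    by simp
qed

lemma weight_on_add_indicator:
  "weight_on G v \<Longrightarrow> weight_on G (\<lambda>z. v z + indicator L z)"
  by (auto simp: weight_on_def)

lemma wnorm_add_indicator_le:
  assumes G: "G \<noteq> {}" and f: "f \<in> Hv G v" and L: "compact L" "L \<subseteq> G"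
  shows "f \<in> Hv G (\<lambda>z. v z + indicator L z)"
    "wnorm G (\<lambda>z. v z + indicator L z) f \<le> wnorm G v f + supnorm L f"
proof -
  have fh: "f \<in> holo G" using f Hv_subset_holo by blast
  have le: "(v z + indicator L z) * cmod (f z) \<le> wnorm G v f + supnorm L f" if "z \<in> G" for z
    using wnorm_ge[OF f that] supnorm_ge[OF fh L, of z] supnorm_nonneg[OF fh L]
    by (cases "z \<in> L") (auto simp: distrib_right)
  show "f \<in> Hv G (\<lambda>z. v z + indicator L z)" using fh le by (rule Hv_I)
  show "wnorm G (\<lambda>z. v z + indicator L z) f \<le> wnorm G v f + supnorm L f" using G le by (rule wnorm_le)
qed

lemma le_wnorm_add_indicator:
  assumes G: "G \<noteq> {}" and v: "weight_on G v" and L: "L \<subseteq> G"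
    and f: "f \<in> Hv G (\<lambda>z. v z + indicator L z)"
  shows "f \<in> Hv G v" "wnorm G v f \<le> wnorm G (\<lambda>z. v z + indicator L z) f"
    "supnorm L f \<le> wnorm G (\<lambda>z. v z + indicator L z) f"
proof -
  let ?w = "\<lambda>z. v z + indicator L z"
  have fh: "f \<in> holo G" using f Hv_subset_holo by blast
  have le: "v z * cmod (f z) \<le> wnorm G ?w f" if "z \<in> G" for z
  proof -
    have "v z * cmod (f z) \<le> ?w z * cmod (f z)" by (intro mult_right_mono) auto
    then show ?thesis using wnorm_ge[OF f that] by simp
  qed
  show "f \<in> Hv G v" using fh le by (rule Hv_I)
  show "wnorm G v f \<le> wnorm G ?w f" using G le by (rule wnorm_le)
  show "supnorm L f \<le> wnorm G ?w f"
  proof (rule supnorm_le)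
    show "0 \<le> wnorm G ?w f" using wnorm_nonneg[OF G weight_on_add_indicator[OF v] f] .
    fix z assume z: "z \<in> L"
    then have "1 * cmod (f z) \<le> ?w z * cmod (f z)"
      using v L by (intro mult_right_mono) (auto simp: weight_on_def)
    then show "cmod (f z) \<le> wnorm G ?w f" using wnorm_ge[OF f, of z] z L by auto
  qed
qed

lemma Hv_add_indicator:
  assumes "G \<noteq> {}" "weight_on G v" "compact L" "L \<subseteq> G"
  shows "Hv G (\<lambda>z. v z + indicator L z) = Hv G v"
  using wnorm_add_indicator_le(1)[OF assms(1) _ assms(3,4)] le_wnorm_add_indicator(1)[OF assms(1,2,4)]
  by blast

text \<open>A norm for \<open>tau\<close> is bounded by one of the seminorms, say the \<open>n\<close>-th, and so can be replaced by it;
  up to a factor of two, that seminorm is the weighted norm for \<open>v\<close> plus the indicator of \<open>K n\<close>.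
  Conversely, this weighted norm is always continuous for \<open>tau\<close>, and in the Banach case it dominates
  all the other seminorms.\<close>
lemma normable_tau_iff:
  assumes G: "open G" "G \<noteq> {}" and v: "weight_on G v" and K: "fundamental_sequence G K"
  shows "normable (Hv G v) (tau G v K) \<longleftrightarrow> (\<exists>L. compact L \<and> L \<subseteq> G \<and>
    banach_on (Hv G (\<lambda>z. v z + indicator L z)) (wnorm G (\<lambda>z. v z + indicator L z)))"
proof
  note KD = fundamental_sequenceD[OF K] and X = linear_subspace_Hv[OF v]
  let ?w = "\<lambda>L z. v z + indicator L z :: real"
  let ?q = "\<lambda>n f. supnorm (K n) f + wnorm G v f"
  assume "normable (Hv G v) (tau G v K)"
  then obtain p where p: "norm_on (Hv G v) p" "tau G v K = seminorm_topology (Hv G v) {p}"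
    by (auto simp: normable_def)
  then have sp: "seminorm_on (Hv G v) p" by (simp add: norm_on_iff_seminorm)
  have "(\<forall>q\<in>range ?q. \<exists>p'\<in>{p}. \<exists>C. \<forall>f\<in>Hv G v. q f \<le> C * p' f) \<and>
      (\<forall>p'\<in>{p}. \<exists>q\<in>range ?q. \<exists>C. \<forall>f\<in>Hv G v. p' f \<le> C * q f)"
    using p(2) seminorm_topology_eq_iff[OF X directed_seminorms_tau[OF G(2) v K]
        directed_seminorms_singleton[OF sp]] by (simp add: tau_def)
  then have D: "\<And>m. \<exists>D. \<forall>f\<in>Hv G v. ?q m f \<le> D * p f"
    and "\<exists>n C. \<forall>f\<in>Hv G v. p f \<le> C * ?q n f" by auto
  then obtain n C where C: "\<And>f. f \<in> Hv G v \<Longrightarrow> p f \<le> C * ?q n f" by metis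
  have w: "weight_on G (?w (K n))" using v by (rule weight_on_add_indicator)
  have "\<exists>B. \<forall>f\<in>Hv G (?w (K n)). supnorm (K m) f \<le> B * wnorm G (?w (K n)) f" for m
  proof -
    obtain D where D: "\<forall>f\<in>Hv G v. ?q m f \<le> D * p f" using D by blast
    have "supnorm (K m) f \<le> (\<bar>D\<bar> * (\<bar>C\<bar> * 2)) * wnorm G (?w (K n)) f" if f: "f \<in> Hv G (?w (K n))" for f
    proof -
      note le = le_wnorm_add_indicator[OF G(2) v KD(2) f]
      have q0: "0 \<le> ?q n f"
        using supnorm_nonneg[OF subsetD[OF Hv_subset_holo le(1)] KD(1,2)] wnorm_nonneg[OF G(2) v le(1)]
        by (rule add_nonneg_nonneg)
      have "supnorm (K m) f \<le> ?q m f" using wnorm_nonneg[OF G(2) v le(1)] by simp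
      also have "\<dots> \<le> D * p f" using D le(1) by blast
      also have "\<dots> \<le> \<bar>D\<bar> * p f" using seminorm_onD(1)[OF sp le(1)] by (intro mult_right_mono) auto
      also have "\<dots> \<le> \<bar>D\<bar> * (\<bar>C\<bar> * ?q n f)"
        using C[OF le(1)] mult_right_mono[OF abs_ge_self q0, of C] by (intro mult_left_mono) auto
      also have "\<dots> \<le> \<bar>D\<bar> * (\<bar>C\<bar> * (2 * wnorm G (?w (K n)) f))"
        using le(2,3) by (intro mult_left_mono) auto
      finally show ?thesis by (simp add: mult.assoc)
    qed
    then show ?thesis by blast
  qed
  then have "banach_on (Hv G (?w (K n))) (wnorm G (?w (K n)))"
    using banach_Hv_iff_dominates_supnorms[OF G w K] by blast
  then show "\<exists>L. compact L \<and> L \<subseteq> G \<and> banach_on (Hv G (?w L)) (wnorm G (?w L))"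
    using KD(1,2) by blast
next
  note KD = fundamental_sequenceD[OF K] and X = linear_subspace_Hv[OF v]
  let ?q = "\<lambda>n f. supnorm (K n) f + wnorm G v f"
  assume "\<exists>L. compact L \<and> L \<subseteq> G \<and>
    banach_on (Hv G (\<lambda>z. v z + indicator L z)) (wnorm G (\<lambda>z. v z + indicator L z))"
  then obtain L where L: "compact L" "L \<subseteq> G"
    and ban: "banach_on (Hv G (\<lambda>z. v z + indicator L z)) (wnorm G (\<lambda>z. v z + indicator L z))" by blast
  define w where "w = (\<lambda>z. v z + indicator L z :: real)"
  have w: "weight_on G w" unfolding w_def using v by (rule weight_on_add_indicator)
  have eq: "Hv G w = Hv G v" unfolding w_def by (rule Hv_add_indicator[OF G(2) v L])
  have norm: "norm_on (Hv G v) (wnorm G w)" using ban unfolding banach_on_def w_def[symmetric] eq by blast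
  then have sw: "seminorm_on (Hv G v) (wnorm G w)" by (simp add: norm_on_iff_seminorm)
  obtain n where n: "L \<subseteq> K n" using KD(4)[OF L] by blast
  have "wnorm G w f \<le> 1 * ?q n f" if f: "f \<in> Hv G v" for f
  proof -
    have "supnorm L f \<le> supnorm (K n) f" using f Hv_subset_holo n by (intro supnorm_mono[of f G] KD) auto
    then show ?thesis using wnorm_add_indicator_le(2)[OF G(2) f L] by (simp add: w_def)
  qed
  then have 1: "\<exists>n C. \<forall>f\<in>Hv G v. wnorm G w f \<le> C * ?q n f" by metis
  have 2: "\<exists>C. \<forall>f\<in>Hv G v. ?q m f \<le> C * wnorm G w f" for m
  proof -
    obtain C where C: "\<forall>f\<in>Hv G v. supnorm (K m) f \<le> C * wnorm G w f"
      using ban banach_Hv_iff_dominates_supnorms[OF G w K] unfolding w_def[symmetric] eq by blast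
    have "?q m f \<le> (C + 1) * wnorm G w f" if f: "f \<in> Hv G v" for f
      using C f le_wnorm_add_indicator(2)[OF G(2) v L(2), of f] eq
      unfolding w_def[symmetric] by (fastforce simp: algebra_simps)
    then show ?thesis by blast
  qed
  have "tau G v K = seminorm_topology (Hv G v) {wnorm G w}"
    unfolding tau_def seminorm_topology_eq_iff[OF X directed_seminorms_tau[OF G(2) v K]
        directed_seminorms_singleton[OF sw]]
    using 1 2 by auto
  then show "normable (Hv G v) (tau G v K)" using norm unfolding normable_def by blast
qed

section \<open>Coincidence with the compact-open topology\<close>

lemma restrict0_in_holo: "f holomorphic_on G \<Longrightarrow> restrict0 G f \<in> holo G"
  by (auto simp: holo_def restrict0_def cong: holomorphic_cong)

text \<open>Only the weighted seminorm can distinguish the two topologies: suprema over compact subsets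
  belong to both of them, because the \<open>K n\<close> exhaust the compact subsets.\<close>
lemma tau_eq_compact_open_iff:
  assumes G: "G \<noteq> {}" and v: "weight_on G v" and K: "fundamental_sequence G K"
  shows "tau G v K = subtopology (tau_co G) (Hv G v) \<longleftrightarrow>
    (\<exists>L C. compact L \<and> L \<subseteq> G \<and> (\<forall>f\<in>Hv G v. wnorm G v f \<le> C * supnorm L f))"
proof -
  note KD = fundamental_sequenceD[OF K] and X = linear_subspace_Hv[OF v]
  let ?q = "\<lambda>n f. supnorm (K n) f + wnorm G v f"
  let ?P = "{supnorm L | L. compact L \<and> L \<subseteq> G}"
  have sub: "subtopology (tau_co G) (Hv G v) = seminorm_topology (Hv G v) ?P"
    unfolding tau_co_def
    by (rule subtopology_seminorm_topology[OF linear_subspace_holo directed_seminorms_supnorm X Hv_subset_holo])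
  have dir: "directed_seminorms (Hv G v) ?P"
    using directed_seminorms_supnorm[of G] Hv_subset_holo[of G v] seminorm_on_subset[OF _ Hv_subset_holo]
    unfolding directed_seminorms_def by (meson subsetD)
  have weaker: "\<forall>p\<in>?P. \<exists>n C. \<forall>f\<in>Hv G v. p f \<le> C * ?q n f"
  proof
    fix p assume "p \<in> ?P"
    then obtain L where L: "p = supnorm L" "compact L" "L \<subseteq> G" by blast
    obtain n where n: "L \<subseteq> K n" using KD(4)[OF L(2,3)] by blast
    have "p f \<le> 1 * ?q n f" if f: "f \<in> Hv G v" for f
    proof -
      have "p f \<le> supnorm (K n) f"
        unfolding L(1) using f Hv_subset_holo n by (intro supnorm_mono[of f G] KD) auto
      then show ?thesis using wnorm_nonneg[OF G v f] by simp
    qed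
    then show "\<exists>n C. \<forall>f\<in>Hv G v. p f \<le> C * ?q n f" by metis
  qed
  have "tau G v K = subtopology (tau_co G) (Hv G v) \<longleftrightarrow>
      (\<forall>n. \<exists>p\<in>?P. \<exists>C. \<forall>f\<in>Hv G v. ?q n f \<le> C * p f)"
    unfolding sub tau_def seminorm_topology_eq_iff[OF X directed_seminorms_tau[OF G v K] dir]
    using weaker by simp
  also have "\<dots> \<longleftrightarrow> (\<forall>n. \<exists>L C. compact L \<and> L \<subseteq> G \<and> (\<forall>f\<in>Hv G v. ?q n f \<le> C * supnorm L f))"
    by blast
  also have "\<dots> \<longleftrightarrow> (\<exists>L C. compact L \<and> L \<subseteq> G \<and> (\<forall>f\<in>Hv G v. wnorm G v f \<le> C * supnorm L f))"
  proof
    assume "\<forall>n. \<exists>L C. compact L \<and> L \<subseteq> G \<and> (\<forall>f\<in>Hv G v. ?q n f \<le> C * supnorm L f)"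
    then obtain L C where LC: "compact L" "L \<subseteq> G" "\<forall>f\<in>Hv G v. ?q 0 f \<le> C * supnorm L f" by blast
    have "wnorm G v f \<le> C * supnorm L f" if f: "f \<in> Hv G v" for f
      using LC(3) f supnorm_nonneg[OF _ KD(1,2), of f 0] Hv_subset_holo by fastforce
    then show "\<exists>L C. compact L \<and> L \<subseteq> G \<and> (\<forall>f\<in>Hv G v. wnorm G v f \<le> C * supnorm L f)"
      using LC by blast
  next
    assume "\<exists>L C. compact L \<and> L \<subseteq> G \<and> (\<forall>f\<in>Hv G v. wnorm G v f \<le> C * supnorm L f)"
    then obtain L C where L: "compact L" "L \<subseteq> G" and C: "\<forall>f\<in>Hv G v. wnorm G v f \<le> C * supnorm L f" by blast
    show "\<forall>n. \<exists>L C. compact L \<and> L \<subseteq> G \<and> (\<forall>f\<in>Hv G v. ?q n f \<le> C * supnorm L f)"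
    proof (intro allI exI conjI ballI)
      fix n
      show M: "compact (K n \<union> L)" "K n \<union> L \<subseteq> G" using L KD(1,2) by auto
      fix f assume f: "f \<in> Hv G v"
      then have fh: "f \<in> holo G" using Hv_subset_holo by blast
      have "wnorm G v f \<le> C * supnorm L f" using C f by blast
      also have "\<dots> \<le> \<bar>C\<bar> * supnorm L f" using supnorm_nonneg[OF fh L] by (intro mult_right_mono) auto
      also have "\<dots> \<le> \<bar>C\<bar> * supnorm (K n \<union> L) f"
        using fh M by (intro mult_left_mono supnorm_mono[of f G]) auto
      finally have "wnorm G v f \<le> \<bar>C\<bar> * supnorm (K n \<union> L) f" .
      moreover have "supnorm (K n) f \<le> supnorm (K n \<union> L) f" using fh M by (intro supnorm_mono[of f G]) auto
      ultimately show "?q n f \<le> (1 + \<bar>C\<bar>) * supnorm (K n \<union> L) f" by (simp add: algebra_simps)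
    qed
  qed
  finally show ?thesis .
qed

lemma wnorm_le_supnorm_of_compact_support:
  assumes G: "G \<noteq> {}" and L: "compact L" "L \<subseteq> G" "positive_set G v \<subseteq> L"
    and B: "\<And>z. z \<in> G \<Longrightarrow> v z \<le> B" and f: "f \<in> holo G"
  shows "wnorm G v f \<le> \<bar>B\<bar> * supnorm L f"
proof (rule wnorm_le[OF G])
  fix z assume z: "z \<in> G"
  show "v z * cmod (f z) \<le> \<bar>B\<bar> * supnorm L f"
  proof (cases "z \<in> L")
    case True
    have "v z * cmod (f z) \<le> \<bar>B\<bar> * cmod (f z)" using B[OF z] by (intro mult_right_mono) auto
    also have "\<dots> \<le> \<bar>B\<bar> * supnorm L f" using supnorm_ge[OF f L(1,2) True] by (rule mult_left_mono) simp
    finally show ?thesis .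
  next
    case False
    then have "v z \<le> 0" using L(3) z by (auto simp: positive_set_def not_less)
    then have "v z * cmod (f z) \<le> 0" by (simp add: mult_nonpos_nonneg)
    then show ?thesis using supnorm_nonneg[OF f L(1,2)] by (simp add: order_trans)
  qed
qed

text \<open>Apply the estimate to the powers \<open>u ^ n\<close>: a constant times \<open>r ^ n\<close> bounds \<open>v z * cmod (u z) ^ n\<close>, while
  \<open>cmod (u z)\<close> exceeds \<open>r\<close>.\<close>
lemma weight_vanishes_where_powers_dominate:
  assumes v: "weight_on G v" and L: "compact L" "L \<subseteq> G"
    and dom: "\<And>f. f \<in> Hv G v \<Longrightarrow> wnorm G v f \<le> C * supnorm L f"
    and u: "\<And>n. restrict0 G (\<lambda>z. u z ^ n) \<in> Hv G v"
    and r: "0 \<le> r" "\<And>z. z \<in> L \<Longrightarrow> cmod (u z) \<le> r" and z: "z \<in> G" "r < cmod (u z)"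
  shows "v z = 0"
proof -
  have uz: "0 < cmod (u z)" using r z by linarith
  have "v z \<le> \<bar>C\<bar> * (r / cmod (u z)) ^ n" for n
  proof -
    let ?f = "restrict0 G (\<lambda>z. u z ^ n)"
    have fh: "?f \<in> holo G" using u Hv_subset_holo by blast
    have "v z * cmod (?f z) \<le> wnorm G v ?f" by (rule wnorm_ge[OF u z(1)])
    also have "\<dots> \<le> C * supnorm L ?f" by (rule dom[OF u])
    also have "\<dots> \<le> \<bar>C\<bar> * supnorm L ?f"
      using supnorm_nonneg[OF fh L] by (intro mult_right_mono) auto
    also have "\<dots> \<le> \<bar>C\<bar> * r ^ n"
      using r L by (intro mult_left_mono supnorm_le) (auto simp: restrict0_def norm_power intro: power_mono)
    finally show ?thesis using z uz by (simp add: restrict0_def norm_power power_divide field_simps)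
  qed
  moreover have "(\<lambda>n. \<bar>C\<bar> * (r / cmod (u z)) ^ n) \<longlonglongrightarrow> \<bar>C\<bar> * 0"
    using r(1) z(2) uz by (intro tendsto_mult tendsto_const LIMSEQ_power_zero) simp
  ultimately have "v z \<le> \<bar>C\<bar> * 0" by (intro LIMSEQ_le_const[of _ _ "v z"]) auto
  moreover have "0 \<le> v z" using v z(1) by (simp add: weight_on_def)
  ultimately show ?thesis by simp
qed

text \<open>The argument needs a function \<open>u\<close> with powers in the space and with compact sublevel sets. On the
  plane, the identity will do. Otherwise take a Riemann map onto the unit disc: the constants
  are in the space, so \<open>v\<close> is bounded and all bounded holomorphic functions are in the space.\<close>
lemma positive_set_subset_compact_if_wnorm_le_supnorm:
  assumes G: "open G" "G \<noteq> {}" "simply_connected G" and v: "weight_on G v"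
    and poly: "\<And>q :: complex poly. restrict0 G (poly q) \<in> Hv G v"
    and L: "compact L" "L \<subseteq> G" and dom: "\<And>f. f \<in> Hv G v \<Longrightarrow> wnorm G v f \<le> C * supnorm L f"
  shows "\<exists>M. compact M \<and> M \<subseteq> G \<and> positive_set G v \<subseteq> M"
proof (cases "G = UNIV")
  case True
  obtain R where R: "0 < R" "\<And>z. z \<in> L \<Longrightarrow> cmod z \<le> R"
    using compact_imp_bounded[OF L(1)] by (auto simp: bounded_pos)
  have "restrict0 G (\<lambda>z. z ^ n) \<in> Hv G v" for n
    using poly[of "monom 1 n"] by (simp add: poly_monom[abs_def])
  then have "v z = 0" if "R < cmod z" for z
    using weight_vanishes_where_powers_dominate[OF v L dom, of "\<lambda>z. z" R z] R that True by simp
  then have "cmod z \<le> R" if "0 < v z" for z using that by (metis less_irrefl not_le)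
  then have "positive_set G v \<subseteq> cball 0 R" by (auto simp: positive_set_def)
  then show ?thesis using True compact_cball by blast
next
  case False
  then obtain \<phi> \<psi> where \<phi>: "\<phi> holomorphic_on G" and \<psi>: "\<psi> holomorphic_on ball 0 1"
    and maps: "\<And>z. z \<in> G \<Longrightarrow> \<phi> z \<in> ball 0 1 \<and> \<psi> (\<phi> z) = z" "\<And>z. z \<in> ball 0 1 \<Longrightarrow> \<psi> z \<in> G"
    using G Riemann_mapping_theorem[of G] by metis
  have "restrict0 G (poly [:1:]) \<in> Hv G v" by (rule poly)
  then obtain B where "\<forall>z\<in>G. v z * cmod (restrict0 G (poly [:1:]) z) \<le> B" using Hv_D by blast
  then have B: "\<And>z. z \<in> G \<Longrightarrow> v z \<le> B" by (auto simp: restrict0_def)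
  have powers: "restrict0 G (\<lambda>z. \<phi> z ^ n) \<in> Hv G v" for n
  proof (rule Hv_I)
    show "restrict0 G (\<lambda>z. \<phi> z ^ n) \<in> holo G" by (intro restrict0_in_holo holomorphic_intros \<phi>)
    fix z assume z: "z \<in> G"
    have "v z * cmod (\<phi> z) ^ n \<le> v z * 1"
      using maps(1)[OF z] v z by (intro mult_left_mono power_le_one) (auto simp: weight_on_def)
    then show "v z * cmod (restrict0 G (\<lambda>z. \<phi> z ^ n) z) \<le> B"
      using B[OF z] z by (simp add: restrict0_def norm_power)
  qed
  obtain r where r: "0 \<le> r" "r < 1" "\<And>z. z \<in> L \<Longrightarrow> cmod (\<phi> z) \<le> r"
  proof (cases "L = {}")
    case True
    then show ?thesis using that[of 0] by simp
  next
    case False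
    have "continuous_on L (\<lambda>z. cmod (\<phi> z))"
      using \<phi> L(2) by (auto intro!: continuous_intros intro: holomorphic_on_imp_continuous_on continuous_on_subset)
    then obtain x where x: "x \<in> L" "\<forall>z\<in>L. cmod (\<phi> z) \<le> cmod (\<phi> x)"
      using continuous_attains_sup[OF L(1) False] by blast
    then show ?thesis using that[of "cmod (\<phi> x)"] maps(1)[of x] L(2) by auto
  qed
  have sub: "cball (0::complex) r \<subseteq> ball 0 1" using r by auto
  have "positive_set G v \<subseteq> \<psi> ` cball 0 r"
  proof
    fix z assume z: "z \<in> positive_set G v"
    then have zG: "z \<in> G" "v z \<noteq> 0" by (auto simp: positive_set_def)
    then have "cmod (\<phi> z) \<le> r"
      using weight_vanishes_where_powers_dominate[OF v L dom powers r(1,3) zG(1)] by (meson not_le)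
    then show "z \<in> \<psi> ` cball 0 r" using maps(1)[OF zG(1)] by (intro image_eqI[of _ _ "\<phi> z"]) auto
  qed
  moreover have "compact (\<psi> ` cball 0 r)"
    using \<psi> sub holomorphic_on_imp_continuous_on continuous_on_subset
    by (intro compact_continuous_image compact_cball) blast
  moreover have "\<psi> ` cball 0 r \<subseteq> G" using maps(2) sub by blast
  ultimately show ?thesis by blast
qed

section \<open>Weights with discrete positivity set\<close>

text \<open>Near a boundary point \<open>a\<close> the function \<open>1 / (z - a)\<close> is larger than on \<open>L\<close>; on the plane, the identity is
  larger near infinity. In both cases this happens on a nonempty open set, which a discrete set
  cannot cover.\<close>
lemma exists_function_larger_off_compact:
  assumes G: "open G" "G \<noteq> {}" and L: "compact L" "L \<subseteq> G" and E: "discrete_in G E"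
  obtains u z r where "u holomorphic_on G" "z \<in> G" "z \<notin> E" "0 < r"
    "\<And>x. x \<in> L \<Longrightarrow> cmod (u x) \<le> r" "r < cmod (u z)"
proof -
  have avoid: "\<exists>z\<in>U. z \<notin> E" if "open U" "U \<noteq> {}" "U \<subseteq> G" for U
  proof (rule ccontr)
    assume "\<not> ?thesis"
    then have "U \<subseteq> E" by blast
    moreover obtain x where x: "x \<in> U" using \<open>U \<noteq> {}\<close> by blast
    ultimately have "x islimpt E"
      using interior_limit_point[of x U] \<open>open U\<close> by (metis interior_open islimpt_subset)
    then show False using E x \<open>U \<subseteq> G\<close> by (auto simp: discrete_in_def)
  qed
  show ?thesis
  proof (cases "G = UNIV")
    case True
    obtain R where R: "0 < R" "\<And>z. z \<in> L \<Longrightarrow> cmod z \<le> R"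
      using compact_imp_bounded[OF L(1)] by (auto simp: bounded_pos)
    have "of_real (R + 1) \<in> - cball (0::complex) R" using R(1) by simp
    then obtain z where "z \<in> - cball 0 R" "z \<notin> E" using avoid[of "- cball 0 R"] True by blast
    then show ?thesis using R True by (intro that[of "\<lambda>z. z" z R]) auto
  next
    case False
    then obtain a where a: "a \<in> frontier G" using G(2) frontier_not_empty by blast
    then have aG: "a \<notin> G" using G(1) by (simp add: frontier_def interior_open)
    have "\<exists>d>0. \<forall>x\<in>L. \<forall>y\<in>{a}. d \<le> dist x y"
      using L aG by (intro separate_compact_closed) auto
    then obtain d where d: "0 < d" "\<And>x. x \<in> L \<Longrightarrow> d \<le> cmod (x - a)" by (auto simp: dist_norm)
    have "ball a d \<inter> G \<noteq> {}"
      using a d(1) unfolding frontier_straddle by (force simp: dist_commute)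
    then obtain z where z: "z \<in> ball a d" "z \<in> G" "z \<notin> E"
      using avoid[OF open_Int[OF open_ball G(1)]] by blast
    show ?thesis
    proof (rule that[of "\<lambda>z. 1 / (z - a)" z "1 / d"])
      show "(\<lambda>z. 1 / (z - a)) holomorphic_on G" using aG by (auto intro!: holomorphic_intros)
      show "cmod (1 / (x - a)) \<le> 1 / d" if "x \<in> L" for x
        using d(1) d(2)[OF that] by (simp add: norm_divide frac_le)
      have "0 < cmod (z - a)" "cmod (z - a) < d" using z aG by (auto simp: dist_norm norm_minus_commute)
      then show "1 / d < cmod (1 / (z - a))" by (simp add: norm_divide frac_less2)
    qed (use z d in auto)
  qed
qed

text \<open>If the positivity set were discrete, it would be the zero set of a holomorphic function \<open>h\<close>. On the
  functions \<open>h * u ^ n\<close> the weight \<open>v\<close> has no effect, so completeness would bound them at a point \<open>z\<close>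
  by a constant multiple of their supremum over \<open>L\<close>. That fails for large \<open>n\<close> if \<open>u\<close> is larger at \<open>z\<close> than on \<open>L\<close> and \<open>h z \<noteq> 0\<close>.\<close>
lemma not_discrete_if_banach_add_indicator:
  assumes G: "open G" "G \<noteq> {}" and v: "weight_on G v" and K: "fundamental_sequence G K"
    and L: "compact L" "L \<subseteq> G"
    and ban: "banach_on (Hv G (\<lambda>z. v z + indicator L z)) (wnorm G (\<lambda>z. v z + indicator L z))"
  shows "\<not> discrete_in G (positive_set G v)"
proof
  let ?E = "positive_set G v" and ?w = "\<lambda>z. v z + indicator L z :: real"
  note KD = fundamental_sequenceD[OF K]
  assume E: "discrete_in G ?E"
  obtain h where h: "h holomorphic_on G" "\<And>z. z \<in> G \<Longrightarrow> h z = 0 \<longleftrightarrow> z \<in> ?E"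
    using holomorphic_with_prescribed_zeros[OF G(1) _ E] by (auto simp: positive_set_def)
  obtain u z r where u: "u holomorphic_on G" and z: "z \<in> G" "z \<notin> ?E" and r: "0 < r"
    "\<And>x. x \<in> L \<Longrightarrow> cmod (u x) \<le> r" "r < cmod (u z)"
    using exists_function_larger_off_compact[OF G L E] by metis
  have w: "weight_on G ?w" using v by (rule weight_on_add_indicator)
  obtain m where m: "{z} \<subseteq> K m" using KD(4)[of "{z}"] z by auto
  obtain C where C: "\<forall>f\<in>Hv G ?w. supnorm (K m) f \<le> C * wnorm G ?w f"
    using ban banach_Hv_iff_dominates_supnorms[OF G w K] by blast
  have hh: "restrict0 G h \<in> holo G" using h(1) by (rule restrict0_in_holo)
  define M where "M = supnorm L (restrict0 G h)"
  have M: "0 \<le> M" "\<And>x. x \<in> L \<Longrightarrow> cmod (h x) \<le> M"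
    using supnorm_nonneg[OF hh L] supnorm_ge[OF hh L] L(2) by (force simp: M_def restrict0_def)+
  have uz: "0 < cmod (u z)" using r by linarith
  have "cmod (h z) \<le> (\<bar>C\<bar> * M) * (r / cmod (u z)) ^ n" for n
  proof -
    let ?f = "restrict0 G (\<lambda>x. h x * u x ^ n)"
    have fh: "?f \<in> holo G" by (intro restrict0_in_holo holomorphic_intros h(1) u)
    have le: "?w x * cmod (?f x) \<le> M * r ^ n" if x: "x \<in> G" for x
    proof (cases "x \<in> ?E")
      case True
      then show ?thesis using h(2)[OF x] M(1) r(1) by (simp add: restrict0_def)
    next
      case False
      then have vx: "v x = 0" using v x by (force simp: positive_set_def weight_on_def)
      show ?thesis
      proof (cases "x \<in> L")
        case True
        then show ?thesis
          using M r x vx by (auto simp: restrict0_def norm_mult norm_power intro!: mult_mono power_mono)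
      next
        case False
        then show ?thesis using vx M(1) r(1) by simp
      qed
    qed
    have fw: "?f \<in> Hv G ?w" using fh le by (rule Hv_I)
    have "cmod (?f z) \<le> supnorm (K m) ?f" using m by (intro supnorm_ge[OF fh KD(1,2)]) auto
    also have "\<dots> \<le> C * wnorm G ?w ?f" using C fw by blast
    also have "\<dots> \<le> \<bar>C\<bar> * wnorm G ?w ?f" using wnorm_nonneg[OF G(2) w fw] by (intro mult_right_mono) auto
    also have "\<dots> \<le> \<bar>C\<bar> * (M * r ^ n)" using wnorm_le[OF G(2) le] by (intro mult_left_mono) auto
    finally show ?thesis using z uz by (simp add: restrict0_def norm_mult norm_power power_divide field_simps)
  qed
  moreover have "(\<lambda>n. (\<bar>C\<bar> * M) * (r / cmod (u z)) ^ n) \<longlonglongrightarrow> (\<bar>C\<bar> * M) * 0"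
    using r uz by (intro tendsto_mult tendsto_const LIMSEQ_power_zero) simp
  ultimately have "cmod (h z) \<le> (\<bar>C\<bar> * M) * 0" by (intro LIMSEQ_le_const[of _ _ "cmod (h z)"]) auto
  then show False using h(2) z by simp
qed

theorem proposition2p8:
  fixes G :: "complex set" and v :: "complex \<Rightarrow> real" and K :: "nat \<Rightarrow> complex set"
  assumes "planar_domain G"
    and "weight_on G v"
    and "fundamental_sequence G K"
  shows
    "((coarser (tau G v K) (tau_v G v) \<longleftrightarrow> tau G v K = tau_v G v) \<and>
      (coarser (tau G v K) (tau_v G v) \<longleftrightarrow> banach_on (Hv G v) (wnorm G v)))
     \<and>
     (normable (Hv G v) (tau G v K) \<longleftrightarrow>
       (\<exists>L. compact L \<and> L \<subseteq> G \<and>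
            (let w = (\<lambda>z. v z + indicator L z) in banach_on (Hv G w) (wnorm G w))))
     \<and>
     (((\<exists>L. compact L \<and> L \<subseteq> G \<and> positive_set G v \<subseteq> L) \<and> bdd_above (v ` G) \<longrightarrow>
        tau G v K = subtopology (tau_co G) (Hv G v)) \<and>
      ((\<forall>q :: complex poly. restrict0 G (poly q) \<in> Hv G v) \<and> simply_connected G \<longrightarrow>
        tau G v K = subtopology (tau_co G) (Hv G v) \<longrightarrow>
        (\<exists>L. compact L \<and> L \<subseteq> G \<and> positive_set G v \<subseteq> L)))
     \<and>
     (normable (Hv G v) (tau G v K) \<longrightarrow> \<not> discrete_in G (positive_set G v))"
proof (intro conjI impI)
  have G: "open G" "G \<noteq> {}" using assms(1) by (auto simp: planar_domain_def)
  note v = assms(2) and K = assms(3)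
  show "coarser (tau G v K) (tau_v G v) \<longleftrightarrow> tau G v K = tau_v G v"
    using tau_eq_tau_v_iff_coarser[OF G(2) v K] by blast
  show "coarser (tau G v K) (tau_v G v) \<longleftrightarrow> banach_on (Hv G v) (wnorm G v)"
    by (rule coarser_tau_tau_v_iff_banach[OF G v K])
  show norm: "normable (Hv G v) (tau G v K) \<longleftrightarrow> (\<exists>L. compact L \<and> L \<subseteq> G \<and>
      (let w = (\<lambda>z. v z + indicator L z) in banach_on (Hv G w) (wnorm G w)))"
    unfolding Let_def by (rule normable_tau_iff[OF G v K])
  show "tau G v K = subtopology (tau_co G) (Hv G v)"
    if support: "(\<exists>L. compact L \<and> L \<subseteq> G \<and> positive_set G v \<subseteq> L) \<and> bdd_above (v ` G)"
  proof -
    obtain L where L: "compact L" "L \<subseteq> G" "positive_set G v \<subseteq> L" using support by blast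
    obtain B where B: "\<And>z. z \<in> G \<Longrightarrow> v z \<le> B" using support unfolding bdd_above_def by blast
    have "wnorm G v f \<le> \<bar>B\<bar> * supnorm L f" if "f \<in> Hv G v" for f
      using wnorm_le_supnorm_of_compact_support[OF G(2) L B subsetD[OF Hv_subset_holo that]] .
    then show ?thesis unfolding tau_eq_compact_open_iff[OF G(2) v K] using L(1,2) by blast
  qed
  show "\<exists>L. compact L \<and> L \<subseteq> G \<and> positive_set G v \<subseteq> L"
    if "(\<forall>q :: complex poly. restrict0 G (poly q) \<in> Hv G v) \<and> simply_connected G"
      and "tau G v K = subtopology (tau_co G) (Hv G v)"
    using that positive_set_subset_compact_if_wnorm_le_supnorm[OF G _ v]
    unfolding tau_eq_compact_open_iff[OF G(2) v K] by blast
  show "\<not> discrete_in G (positive_set G v)" if "normable (Hv G v) (tau G v K)"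
    using that not_discrete_if_banach_add_indicator[OF G v K] normable_tau_iff[OF G v K] by blast
qed

end
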